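(* Let $a,b$ be positive integers with $\gcd(a,b)=1$, let ${\sf core}(a,b)$ be the (finite) set of simultaneous $(a,b)$-cores, and let $\mu$ be the average of ${\sf size}(\lambda)$ over $\lambda\in{\sf core}(a,b)$. Then \[\sum_{\lambda \in {\sf core}(a,b)} \left({\sf size}(\lambda)-\mu\right)^3 = \frac{ab(a-1) (b-1) (a+b) (a+b+1) \left(2 a^2 b-3 a^2+2 a b^2-3 a b-3 b^2-3 \right)}{60480}.\]
   Context: An integer partition $\lambda$ is an $a$-core if no hook length of its Ferrers diagram is divisible by $a$. An $(a,b)$-core is a partition that is both an $a$-core and a $b$-core. For a partition $\lambda$ of $k$, ${\sf size}(\lambda):=k$ (the number of boxes).
   Formalization: The formal statement divides the sum of (size(λ)−μ)³ by the number of (a,b)-cores; as printed the identity is false: for (a,b)=(2,5) the sizes are 0, 1, 3, the sum is 20/9, but the right-hand side is 20/27. *)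

theory Defs
  imports Complex_Main
begin

text \<open>
  An integer partition is the list of its positive parts in weakly decreasing order, so that
  distinct lists are distinct partitions and the empty list is the partition of 0.
\<close>

definition is_partition :: "nat list \<Rightarrow> bool" where
  "is_partition l \<longleftrightarrow> sorted_wrt (\<ge>) l \<and> 0 \<notin> set l"

definition partition_size :: "nat list \<Rightarrow> nat" where
  "partition_size l = sum_list l"

text \<open>Boxes are (row, column) pairs, both counted from 0.\<close>

definition ferrers :: "nat list \<Rightarrow> (nat \<times> nat) set" where
  "ferrers l = {(i, j). i < length l \<and> j < l ! i}"

text \<open>
  The hook of a box consists of the box itself, the boxes to its right in the same row and the
  boxes below it in the same column.
\<close>

definition hook :: "nat list \<Rightarrow> nat \<times> nat \<Rightarrow> (nat \<times> nat) set" where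
  "hook l c = {d \<in> ferrers l. (fst d = fst c \<and> snd c \<le> snd d) \<or> (snd d = snd c \<and> fst c \<le> fst d)}"

definition hook_length :: "nat list \<Rightarrow> nat \<times> nat \<Rightarrow> nat" where
  "hook_length l c = card (hook l c)"

definition is_core :: "nat \<Rightarrow> nat list \<Rightarrow> bool" where
  "is_core a l \<longleftrightarrow> is_partition l \<and> (\<forall>c\<in>ferrers l. \<not> a dvd hook_length l c)"

definition core :: "nat \<Rightarrow> nat \<Rightarrow> nat list set" where
  "core a b = {l. is_core a l \<and> is_core b l}"

definition mean_core_size :: "nat \<Rightarrow> nat \<Rightarrow> real" where
  "mean_core_size a b = (\<Sum>l\<in>core a b. real (partition_size l)) / real (card (core a b))"

end

theory Submission
  imports Defs "HOL-Number_Theory.Cong"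
begin

text \<open>
  Beta numbers identify \<open>(a,b)\<close>-cores with the finite complements in \<open>\<nat>\<close> of sets containing 0 that
  are closed under adding \<open>a\<close> and \<open>b\<close>. Reading off the least element of such a set in each residue
  class modulo \<open>a\<close>, in the order \<open>0, b, 2b, \<dots>\<close>, gives heights
  \<open>y\<^sub>j = j b - a (z\<^sub>0 + \<dots> + z\<^sub>j\<^sub>-\<^sub>1) \<ge> 0\<close> for a weak composition \<open>z\<close> of \<open>b\<close> into \<open>a\<close> parts, that is, a
  rational Dyck path, and the size of the core is
  \<open>(\<Sum>y\<^sub>j\<^sup>2 / a - (\<Sum>y\<^sub>j)\<^sup>2 / a\<^sup>2) / 2 - (a\<^sup>2 - 1) / 24\<close>. This expression does not change when \<open>z\<close> is rotated,
  and since \<open>a\<close> and \<open>b\<close> are coprime exactly one of the \<open>a\<close> rotations of \<open>z\<close> is a Dyck path. Hence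
  averages over cores are averages over all weak compositions. There the joint moments of the two
  power sums, viewed as functions of the end point of the path, satisfy a recurrence on the last
  step whose solution is a binomial coefficient times an explicit polynomial.
\<close>

section \<open>Moments over weak compositions\<close>

definition compositions :: "nat \<Rightarrow> nat \<Rightarrow> nat list set" where
  "compositions k n = {z. length z = k \<and> sum_list z = n}"

text \<open>For \<open>d\<^sub>j = t j - (z\<^sub>0 + \<dots> + z\<^sub>j\<^sub>-\<^sub>1)\<close>, \<open>area z\<close> is \<open>2 \<Sum>d\<^sub>j\<close> when \<open>t\<close> is the slope of the chord of
  the path. Centring by the chord keeps it independent of \<open>t\<close> and makes its odd moments vanish.\<close>

definition area :: "nat list \<Rightarrow> real" where
  "area z = real (sum_list z) * (real (length z) - 1)
     - 2 * (\<Sum>j<length z. real (sum_list (take j z)))"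

definition energy :: "real \<Rightarrow> nat list \<Rightarrow> real" where
  "energy t z = (\<Sum>j<length z. (t * real j - real (sum_list (take j z)))^2)"

text \<open>Compositions of \<open>n\<close> into \<open>m + 1\<close> parts are the lattice paths
  from the origin to \<open>(m, n)\<close>; there are \<open>(m + n) choose n\<close> of them. The
  slope \<open>t\<close> is a free parameter, so that it stays fixed while the end point
  moves.\<close>

definition path_moment :: "nat \<Rightarrow> nat \<Rightarrow> real \<Rightarrow> nat \<Rightarrow> nat \<Rightarrow> real" where
  "path_moment p q t m n = (\<Sum>z\<in>compositions (Suc m) n. area z ^ p * energy t z ^ q)"

section \<open>Recurrence on the last step of a lattice path\<close>

definition incr_last :: "nat list \<Rightarrow> nat list" where
  "incr_last z = butlast z @ [Suc (last z)]"

lemma finite_compositions: "finite (compositions k n)"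
proof (rule finite_subset)
  show "compositions k n \<subseteq> {z. set z \<subseteq> {..n} \<and> length z = k}"
    by (auto simp: compositions_def member_le_sum_list)
qed (simp add: finite_lists_length_eq)

lemma compositions_Suc_0: "compositions (Suc m) 0 = (\<lambda>z. z @ [0]) ` compositions m 0"
proof -
  have "z \<in> (\<lambda>z. z @ [0]) ` compositions m 0" if "z \<in> compositions (Suc m) 0" for z
    using that by (cases z rule: rev_cases) (auto simp: compositions_def)
  then show ?thesis
    by (auto simp: compositions_def)
qed

lemma compositions_Suc_Suc:
  "compositions (Suc m) (Suc n) =
     incr_last ` compositions (Suc m) n \<union> (\<lambda>z. z @ [0]) ` compositions m (Suc n)"
proof -
  have "z \<in> incr_last ` compositions (Suc m) n \<union> (\<lambda>z. z @ [0]) ` compositions m (Suc n)"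
    if z: "z \<in> compositions (Suc m) (Suc n)" for z
  proof -
    obtain w k where w: "z = w @ [k]"
      using z by (cases z rule: rev_cases) (auto simp: compositions_def)
    show ?thesis
    proof (cases k)
      case 0
      then show ?thesis using z w by (auto simp: compositions_def)
    next
      case (Suc k')
      have "z = incr_last (w @ [k'])" "w @ [k'] \<in> compositions (Suc m) n"
        using z w Suc by (auto simp: compositions_def incr_last_def)
      then show ?thesis by blast
    qed
  qed
  moreover have "incr_last z \<in> compositions (Suc m) (Suc n)" if "z \<in> compositions (Suc m) n" for z
    using that by (cases z rule: rev_cases) (auto simp: compositions_def incr_last_def)
  ultimately show ?thesis
    by (auto simp: compositions_def)
qed

lemma inj_on_incr_last: "inj_on incr_last (compositions (Suc m) n)"
proof (rule inj_onI)
  fix z w assume "z \<in> compositions (Suc m) n" "w \<in> compositions (Suc m) n" "incr_last z = incr_last w"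
  then show "z = w"
    by (cases z rule: rev_cases; cases w rule: rev_cases) (auto simp: compositions_def incr_last_def)
qed

text \<open>Pascal's rule for lattice paths: the last step is vertical (\<open>incr_last\<close>) or
  horizontal (appending 0). At \<open>n = 0\<close> there is no vertical step, which the truncated
  \<open>n - 1\<close> would miss.\<close>

lemma sum_compositions_Suc:
  fixes f :: "nat list \<Rightarrow> real"
  shows "(\<Sum>z\<in>compositions (Suc m) n. f z) =
    (if n = 0 then 0 else \<Sum>z\<in>compositions (Suc m) (n - 1). f (incr_last z)) +
    (\<Sum>z\<in>compositions m n. f (z @ [0]))"
proof -
  have app: "(\<Sum>z\<in>(\<lambda>z. z @ [0]) ` compositions m n. f z) = (\<Sum>z\<in>compositions m n. f (z @ [0]))" for n
    by (subst sum.reindex) (auto simp: inj_on_def)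
  show ?thesis
  proof (cases n)
    case 0
    then show ?thesis by (simp add: compositions_Suc_0 app)
  next
    case (Suc n')
    have "incr_last ` compositions (Suc m) n' \<inter> (\<lambda>z. z @ [0]) ` compositions m n = {}"
      by (auto simp: incr_last_def)
    then have "(\<Sum>z\<in>compositions (Suc m) n. f z) =
        (\<Sum>z\<in>incr_last ` compositions (Suc m) n'. f z) + (\<Sum>z\<in>(\<lambda>z. z @ [0]) ` compositions m n. f z)"
      unfolding Suc compositions_Suc_Suc
      by (intro sum.union_disjoint finite_imageI finite_compositions) auto
    then show ?thesis
      using Suc by (simp add: app sum.reindex[OF inj_on_incr_last])
  qed
qed

text \<open>The new proper prefix is all of \<open>z\<close>, with sum \<open>n\<close>: the
  subtracted term grows by \<open>2 n\<close>, the product term by \<open>n\<close>.\<close>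

lemma area_snoc_0:
  assumes "z \<in> compositions m n"
  shows "area (z @ [0]) = area z - real n"
proof -
  have "(\<Sum>j<m. real (sum_list (take j (z @ [0])))) = (\<Sum>j<m. real (sum_list (take j z)))"
    using assms by (intro sum.cong) (auto simp: compositions_def)
  then show ?thesis
    using assms by (simp add: area_def compositions_def algebra_simps)
qed

lemma energy_snoc_0:
  assumes "z \<in> compositions m n"
  shows "energy t (z @ [0]) = energy t z + (t * real m - real n)^2"
proof -
  have "(\<Sum>j<m. (t * real j - real (sum_list (take j (z @ [0]))))^2) =
      (\<Sum>j<m. (t * real j - real (sum_list (take j z)))^2)"
    using assms by (intro sum.cong) (auto simp: compositions_def)
  then show ?thesis
    using assms by (simp add: energy_def compositions_def)
qed

text \<open>Only proper prefixes enter \<open>area\<close> and \<open>energy\<close>, so raising the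
  last part changes nothing but the total in \<open>area\<close>.\<close>

lemma sum_list_take_incr_last:
  assumes "z \<in> compositions (Suc m) n" "j < Suc m"
  shows "sum_list (take j (incr_last z)) = sum_list (take j z)"
  using assms by (cases z rule: rev_cases) (auto simp: compositions_def incr_last_def)

lemma area_incr_last:
  assumes "z \<in> compositions (Suc m) n"
  shows "area (incr_last z) = area z + real m"
proof -
  have "(\<Sum>j<Suc m. real (sum_list (take j (incr_last z)))) = (\<Sum>j<Suc m. real (sum_list (take j z)))"
    using assms by (intro sum.cong) (simp_all add: sum_list_take_incr_last)
  moreover have "incr_last z \<in> compositions (Suc m) (Suc n)"
    using assms by (auto simp: compositions_Suc_Suc)
  ultimately show ?thesis
    using assms by (simp add: area_def compositions_def algebra_simps del: sum.lessThan_Suc)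
qed

lemma energy_incr_last:
  assumes "z \<in> compositions (Suc m) n"
  shows "energy t (incr_last z) = energy t z"
proof -
  have "incr_last z \<in> compositions (Suc m) (Suc n)"
    using assms by (auto simp: compositions_Suc_Suc)
  then show ?thesis
    using assms by (simp add: energy_def compositions_def
      sum_list_take_incr_last[OF assms] del: sum.lessThan_Suc cong: sum.cong_simp)
qed

text \<open>The last step shifts \<open>area\<close> and \<open>energy\<close> by amounts that
  depend on the end point only, and the binomial theorem expands the shifted powers. The assumption
  excludes the one-point path, which has no last step.\<close>

lemma path_moment_rec:
  assumes "0 < m + n"
  shows "path_moment p q t m n =
    (if n = 0 then 0 else
       \<Sum>i\<le>p. real (p choose i) * real m ^ (p - i) * path_moment i q t m (n - 1)) +
    (if m = 0 then 0 else
       \<Sum>i\<le>p. \<Sum>j\<le>q. real (p choose i) * real (q choose j) * (- real n) ^ (p - i) *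
         (t * real m - real n) ^ (2 * (q - j)) * path_moment i j t (m - 1) n)"
proof -
  have 1: "(\<Sum>z\<in>compositions (Suc m) (n - 1). area (incr_last z) ^ p * energy t (incr_last z) ^ q) =
     (\<Sum>i\<le>p. real (p choose i) * real m ^ (p - i) * path_moment i q t m (n - 1))"
  proof -
    have "area (incr_last z) ^ p * energy t (incr_last z) ^ q =
       (\<Sum>i\<le>p. real (p choose i) * real m ^ (p - i) * (area z ^ i * energy t z ^ q))"
      if "z \<in> compositions (Suc m) (n - 1)" for z
      unfolding area_incr_last[OF that] energy_incr_last[OF that] binomial_ring sum_distrib_right
      by (intro sum.cong) (auto simp: mult_ac)
    then have "(\<Sum>z\<in>compositions (Suc m) (n - 1). area (incr_last z) ^ p * energy t (incr_last z) ^ q) =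
       (\<Sum>z\<in>compositions (Suc m) (n - 1).
          \<Sum>i\<le>p. real (p choose i) * real m ^ (p - i) * (area z ^ i * energy t z ^ q))"
      by (rule sum.cong[OF refl])
    also have "\<dots> = (\<Sum>i\<le>p. real (p choose i) * real m ^ (p - i) * path_moment i q t m (n - 1))"
      by (subst sum.swap) (simp add: path_moment_def sum_distrib_left)
    finally show ?thesis .
  qed
  have 2: "(\<Sum>z\<in>compositions m n. area (z @ [0]) ^ p * energy t (z @ [0]) ^ q) =
     (\<Sum>i\<le>p. \<Sum>j\<le>q. real (p choose i) * real (q choose j) * (- real n) ^ (p - i) *
         (t * real m - real n) ^ (2 * (q - j)) * path_moment i j t (m - 1) n)"
    if "m \<noteq> 0"
  proof -
    have "area (z @ [0]) ^ p * energy t (z @ [0]) ^ q =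
       (\<Sum>i\<le>p. \<Sum>j\<le>q. real (p choose i) * real (q choose j) * (- real n) ^ (p - i) *
         (t * real m - real n) ^ (2 * (q - j)) * (area z ^ i * energy t z ^ j))"
      if "z \<in> compositions m n" for z
      unfolding area_snoc_0[OF that] energy_snoc_0[OF that] diff_conv_add_uminus[of "area z"]
        binomial_ring sum_product power_mult[of _ 2]
      by (intro sum.cong) (simp_all add: mult_ac)
    then have "(\<Sum>z\<in>compositions m n. area (z @ [0]) ^ p * energy t (z @ [0]) ^ q) =
       (\<Sum>z\<in>compositions m n. \<Sum>i\<le>p. \<Sum>j\<le>q. real (p choose i) * real (q choose j) *
         (- real n) ^ (p - i) * (t * real m - real n) ^ (2 * (q - j)) *
         (area z ^ i * energy t z ^ j))"
      by (rule sum.cong[OF refl])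
    also have "\<dots> = (\<Sum>i\<le>p. \<Sum>j\<le>q. \<Sum>z\<in>compositions m n. real (p choose i) * real (q choose j) *
         (- real n) ^ (p - i) * (t * real m - real n) ^ (2 * (q - j)) *
         (area z ^ i * energy t z ^ j))"
      by (subst sum.swap, intro sum.cong refl, rule sum.swap)
    finally show ?thesis
      using that by (simp add: path_moment_def sum_distrib_left)
  qed
  have 3: "compositions m n = {}" if "m = 0"
    using that assms by (auto simp: compositions_def)
  show ?thesis
    unfolding path_moment_def[of p q t m n] sum_compositions_Suc[of _ m n] 1
    using 2 3 by (cases "m = 0") (simp_all only: sum.empty if_True if_False not_False_eq_True refl)
qed

text \<open>These solve the recurrence \<open>moment_poly_rec\<close> below. Moving the terms with \<open>(i, j) = (p, q)\<close> to its
  left side leaves, to leading order, the Euler operator \<open>m \<partial>\<^sub>m + n \<partial>\<^sub>n\<close>, so it can be solved by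
  descending degree; 7560 clears all denominators. The value 0 is correct for odd \<open>p \<le> 5\<close> with
  \<open>q = 0\<close> and junk for \<open>p + 2 q > 6\<close>.\<close>

definition moment_poly :: "nat \<Rightarrow> nat \<Rightarrow> real \<Rightarrow> real \<Rightarrow> real \<Rightarrow> real" where
  "moment_poly p q t m n = (
   if p = 0 \<and> q = 0 then
    7560
   else if p = 2 \<and> q = 0 then
    2520*m^2*n + 2520*m*n^2 + 2520*m*n
   else if p = 0 \<and> q = 1 then
    2520*m*n^2 + 1260*m*n - 5040*m^2*n*t - 2520*m*n*t + 2520*m^3*t^2 + 3780*m^2*t^2
    + 1260*m*t^2
   else if p = 1 \<and> q = 1 then
    -1260*m^2*n^2 - 1260*m*n^3 - 1260*m*n^2 + 1260*m^3*n*t + 1260*m^2*n^2*t + 2520*m^2*n*t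
    + 1260*m*n^2*t + 1260*m*n*t
   else if p = 4 \<and> q = 0 then
    2520*m^4*n^2 + 5040*m^3*n^3 + 2520*m^2*n^4 - 1008*m^4*n + 3024*m^3*n^2 + 3024*m^2*n^3
    - 1008*m*n^4 - 2016*m^3*n - 504*m^2*n^2 - 2016*m*n^3 - 1008*m^2*n - 1008*m*n^2
   else if p = 2 \<and> q = 1 then
    840*m^3*n^3 + 840*m^2*n^4 + 756*m^3*n^2 + 1764*m^2*n^3 + 168*m*n^4 - 336*m^3*n
    + 420*m^2*n^2 + 168*m*n^3 - 504*m^2*n - 168*m*n^2 - 168*m*n - 1680*m^4*n^2*t
    - 1680*m^3*n^3*t + 168*m^4*n*t - 2016*m^3*n^2*t - 504*m^2*n^3*t + 168*m^3*n*t
    - 840*m^2*n^2*t - 336*m*n^3*t - 168*m^2*n*t - 504*m*n^2*t - 168*m*n*t + 840*m^5*n*t^2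
    + 840*m^4*n^2*t^2 + 2100*m^4*n*t^2 + 1260*m^3*n^2*t^2 + 1680*m^3*n*t^2 + 420*m^2*n^2*t^2
    + 420*m^2*n*t^2
   else if p = 0 \<and> q = 2 then
    840*m^2*n^4 + 1512*m^2*n^3 + 672*m*n^4 + 294*m^2*n^2 + 756*m*n^3 - 126*m^2*n - 42*m*n^2
    - 126*m*n - 3360*m^3*n^3*t - 3024*m^3*n^2*t - 3024*m^2*n^3*t + 84*m^3*n*t
    - 3276*m^2*n^2*t - 1176*m*n^3*t - 1260*m*n^2*t - 84*m*n*t + 5040*m^4*n^2*t^2
    + 1512*m^4*n*t^2 + 6552*m^3*n^2*t^2 + 3276*m^3*n*t^2 + 3024*m^2*n^2*t^2 + 2268*m^2*n*t^2
    + 504*m*n^2*t^2 + 504*m*n*t^2 - 3360*m^5*n*t^3 - 6720*m^4*n*t^3 - 4200*m^3*n*t^3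
    - 840*m^2*n*t^3 + 840*m^6*t^4 + 2520*m^5*t^4 + 2730*m^4*t^4 + 1260*m^3*t^4 + 210*m^2*t^4
   else if p = 3 \<and> q = 1 then
    -1260*m^4*n^3 - 2520*m^3*n^4 - 1260*m^2*n^5 + 504*m^4*n^2 - 1512*m^3*n^3 - 1512*m^2*n^4
    + 504*m*n^5 + 1008*m^3*n^2 + 252*m^2*n^3 + 1008*m*n^4 + 504*m^2*n^2 + 504*m*n^3
    + 1260*m^5*n^2*t + 2520*m^4*n^3*t + 1260*m^3*n^4*t - 504*m^5*n*t + 2772*m^4*n^2*t
    + 4032*m^3*n^3*t + 756*m^2*n^4*t - 1512*m^4*n*t + 1260*m^3*n^2*t + 504*m^2*n^3*t
    - 504*m*n^4*t - 1512*m^3*n*t - 756*m^2*n^2*t - 1008*m*n^3*t - 504*m^2*n*t - 504*m*n^2*t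
   else if p = 1 \<and> q = 2 then
    -840*m^3*n^4 - 840*m^2*n^5 - 756*m^3*n^3 - 1764*m^2*n^4 - 168*m*n^5 + 336*m^3*n^2
    - 420*m^2*n^3 - 168*m*n^4 + 504*m^2*n^2 + 168*m*n^3 + 168*m*n^2 + 2520*m^4*n^3*t
    + 2520*m^3*n^4*t + 588*m^4*n^2*t + 4620*m^3*n^3*t + 1512*m^2*n^4*t - 336*m^4*n*t
    + 1008*m^3*n^2*t + 2772*m^2*n^3*t + 504*m*n^4*t - 840*m^3*n*t + 420*m^2*n^2*t
    + 672*m*n^3*t - 672*m^2*n*t - 168*m*n*t - 2520*m^5*n^2*t^2 - 2520*m^4*n^3*t^2
    + 168*m^5*n*t^2 - 5796*m^4*n^2*t^2 - 3444*m^3*n^3*t^2 + 336*m^4*n*t^2 - 4536*m^3*n^2*t^2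
    - 1260*m^2*n^3*t^2 - 1764*m^2*n^2*t^2 - 336*m*n^3*t^2 - 336*m^2*n*t^2 - 504*m*n^2*t^2
    - 168*m*n*t^2 + 840*m^6*n*t^3 + 840*m^5*n^2*t^3 + 2940*m^5*n*t^3 + 2100*m^4*n^2*t^3
    + 3780*m^4*n*t^3 + 1680*m^3*n^2*t^3 + 2100*m^3*n*t^3 + 420*m^2*n^2*t^3 + 420*m^2*n*t^3
   else if p = 6 \<and> q = 0 then
    4200*m^6*n^3 + 12600*m^5*n^4 + 12600*m^4*n^5 + 4200*m^3*n^6 - 5040*m^6*n^2
    - 2520*m^5*n^3 + 5040*m^4*n^4 - 2520*m^3*n^5 - 5040*m^2*n^6 + 1920*m^6*n - 9360*m^5*n^2
    - 13080*m^4*n^3 - 13080*m^3*n^4 - 9360*m^2*n^5 + 1920*m*n^6 + 5760*m^5*n - 720*m^4*n^2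
    - 1800*m^3*n^3 - 720*m^2*n^4 + 5760*m*n^5 + 4800*m^4*n + 4560*m^3*n^2 + 4560*m^2*n^3
    + 4800*m*n^4 - 960*m^2*n - 960*m*n^2
   else if p = 4 \<and> q = 1 then
    840*m^5*n^4 + 1680*m^4*n^5 + 840*m^3*n^6 + 756*m^5*n^3 + 3528*m^4*n^4 + 2772*m^3*n^5
    - 1416*m^5*n^2 - 1608*m^4*n^3 + 144*m^3*n^4 - 1032*m^2*n^5 - 192*m*n^6 + 576*m^5*n
    - 2016*m^4*n^2 - 2724*m^3*n^3 - 1536*m^2*n^4 - 288*m*n^5 + 1440*m^4*n + 24*m^3*n^2
    + 24*m^2*n^3 + 192*m*n^4 + 960*m^3*n + 528*m^2*n^2 + 384*m*n^3 - 96*m*n - 1680*m^6*n^3*t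
    - 3360*m^5*n^4*t - 1680*m^4*n^5*t + 1008*m^6*n^2*t - 1512*m^5*n^3*t - 2016*m^4*n^4*t
    + 504*m^3*n^5*t - 192*m^6*n*t + 1488*m^5*n^2*t - 864*m^4*n^3*t - 1104*m^3*n^4*t
    - 912*m^2*n^5*t - 288*m^5*n*t + 480*m^4*n^2*t - 1464*m^3*n^3*t - 1008*m^2*n^4*t
    + 576*m*n^5*t + 192*m^4*n*t + 528*m^3*n^2*t + 528*m^2*n^3*t + 1440*m*n^4*t + 384*m^3*n*t
    + 528*m^2*n^2*t + 960*m*n^3*t - 96*m*n*t + 840*m^7*n^2*t^2 + 1680*m^6*n^3*t^2
    + 840*m^5*n^4*t^2 - 336*m^7*n*t^2 + 2268*m^6*n^2*t^2 + 3528*m^5*n^3*t^2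
    + 924*m^4*n^4*t^2 - 1176*m^6*n*t^2 + 1764*m^5*n^2*t^2 + 1680*m^4*n^3*t^2
    - 84*m^3*n^4*t^2 - 1512*m^5*n*t^2 - 84*m^4*n^2*t^2 - 504*m^3*n^3*t^2 - 168*m^2*n^4*t^2
    - 840*m^4*n*t^2 - 588*m^3*n^2*t^2 - 336*m^2*n^3*t^2 - 168*m^3*n*t^2 - 168*m^2*n^2*t^2
   else if p = 2 \<and> q = 2 then
    280*m^4*n^5 + 280*m^3*n^6 + 1148*m^4*n^4 + 2184*m^3*n^5 + 756*m^2*n^6 - 190*m^4*n^3
    + 1510*m^3*n^4 + 1064*m^2*n^5 - 244*m*n^6 - 410*m^4*n^2 - 1158*m^3*n^3 - 302*m^2*n^4
    - 540*m*n^5 + 180*m^4*n - 404*m^3*n^2 - 740*m^2*n^3 - 304*m*n^4 + 360*m^3*n + 50*m^2*n^2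
    + 36*m*n^3 + 180*m^2*n + 44*m*n^2 - 1120*m^5*n^4*t - 1120*m^4*n^5*t - 2184*m^5*n^3*t
    - 5152*m^4*n^4*t - 1848*m^3*n^5*t + 1156*m^5*n^2*t - 3152*m^4*n^3*t - 4916*m^3*n^4*t
    - 944*m^2*n^5*t - 120*m^5*n*t + 2236*m^4*n^2*t - 1656*m^3*n^3*t - 1292*m^2*n^4*t
    + 384*m*n^5*t - 120*m^4*n*t + 1748*m^3*n^2*t + 320*m^2*n^3*t + 888*m*n^4*t + 120*m^3*n*t
    + 788*m^2*n^2*t + 624*m*n^3*t + 120*m^2*n*t + 120*m*n^2*t + 1680*m^6*n^3*t^2
    + 1680*m^5*n^4*t^2 + 924*m^6*n^2*t^2 + 4872*m^5*n^3*t^2 + 2268*m^4*n^4*t^2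
    - 468*m^6*n*t^2 + 2856*m^5*n^2*t^2 + 6732*m^4*n^3*t^2 + 2064*m^3*n^4*t^2
    - 1716*m^5*n*t^2 + 2568*m^4*n^2*t^2 + 3588*m^3*n^3*t^2 + 108*m^2*n^4*t^2
    - 2292*m^4*n*t^2 + 240*m^3*n^2*t^2 - 96*m^2*n^3*t^2 - 72*m*n^4*t^2 - 1308*m^3*n*t^2
    - 468*m^2*n^2*t^2 - 144*m*n^3*t^2 - 264*m^2*n*t^2 - 72*m*n^2*t^2 - 1120*m^7*n^2*t^3
    - 1120*m^6*n^3*t^3 + 112*m^7*n*t^3 - 3024*m^6*n^2*t^3 - 2016*m^5*n^3*t^3 + 280*m^6*n*t^3
    - 3136*m^5*n^2*t^3 - 1288*m^4*n^3*t^3 + 112*m^5*n*t^3 - 1848*m^4*n^2*t^3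
    - 504*m^3*n^3*t^3 - 224*m^4*n*t^3 - 784*m^3*n^2*t^3 - 112*m^2*n^3*t^3 - 224*m^3*n*t^3
    - 168*m^2*n^2*t^3 - 56*m^2*n*t^3 + 280*m^8*n*t^4 + 280*m^7*n^2*t^4 + 1120*m^7*n*t^4
    + 840*m^6*n^2*t^4 + 1750*m^6*n*t^4 + 910*m^5*n^2*t^4 + 1330*m^5*n*t^4 + 420*m^4*n^2*t^4
    + 490*m^4*n*t^4 + 70*m^3*n^2*t^4 + 70*m^3*n*t^4
   else if p = 0 \<and> q = 3 then
    280*m^3*n^6 + 1092*m^3*n^5 + 672*m^2*n^6 + 886*m^3*n^4 + 1476*m^2*n^5 + 128*m*n^6
    - 297*m^3*n^3 + 348*m^2*n^4 + 132*m*n^5 - 131*m^3*n^2 - 621*m^2*n^3 - 154*m*n^4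
    + 60*m^3*n - 75*m^2*n^2 - 162*m*n^3 + 90*m^2*n + 26*m*n^2 + 30*m*n - 1680*m^4*n^5*t
    - 4368*m^4*n^4*t - 3528*m^3*n^5*t - 1560*m^4*n^3*t - 6516*m^3*n^4*t - 1848*m^2*n^5*t
    + 858*m^4*n^2*t - 1692*m^3*n^3*t - 3552*m^2*n^4*t - 504*m*n^5*t - 54*m^4*n*t
    + 1548*m^3*n^2*t - 636*m^2*n^3*t - 684*m*n^4*t - 18*m^3*n*t + 1068*m^2*n^2*t
    + 108*m*n^3*t + 54*m^2*n*t + 306*m*n^2*t + 18*m*n*t + 4200*m^5*n^4*t^2
    + 6552*m^5*n^3*t^2 + 8652*m^4*n^4*t^2 + 462*m^5*n^2*t^2 + 12888*m^4*n^3*t^2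
    + 6924*m^3*n^4*t^2 - 378*m^5*n*t^2 + 1383*m^4*n^2*t^2 + 10026*m^3*n^3*t^2
    + 2328*m^2*n^4*t^2 - 1251*m^4*n*t^2 + 1212*m^3*n^2*t^2 + 3690*m^2*n^3*t^2
    + 576*m*n^4*t^2 - 1404*m^3*n*t^2 + 543*m^2*n^2*t^2 + 864*m*n^3*t^2 - 639*m^2*n*t^2
    + 180*m*n^2*t^2 - 108*m*n*t^2 - 5600*m^6*n^3*t^3 - 4368*m^6*n^2*t^3 - 12768*m^5*n^3*t^3
    + 212*m^6*n*t^3 - 12132*m^5*n^2*t^3 - 12176*m^4*n^3*t^3 + 510*m^5*n*t^3
    - 12630*m^4*n^2*t^3 - 5652*m^3*n^3*t^3 + 182*m^4*n*t^3 - 6480*m^3*n^2*t^3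
    - 1412*m^2*n^3*t^3 - 414*m^3*n*t^3 - 1902*m^2*n^2*t^3 - 192*m*n^3*t^3 - 394*m^2*n*t^3
    - 288*m*n^2*t^3 - 96*m*n*t^3 + 4200*m^7*n^2*t^4 + 1092*m^7*n*t^4 + 11592*m^6*n^2*t^4
    + 4284*m^6*n*t^4 + 12642*m^5*n^2*t^4 + 6573*m^5*n*t^4 + 7056*m^4*n^2*t^4
    + 4914*m^4*n*t^4 + 2058*m^3*n^2*t^4 + 1785*m^3*n*t^4 + 252*m^2*n^2*t^4 + 252*m^2*n*t^4
    - 1680*m^8*n*t^5 - 5880*m^7*n*t^5 - 7980*m^6*n*t^5 - 5250*m^5*n*t^5 - 1680*m^4*n*t^5
    - 210*m^3*n*t^5 + 280*m^9*t^6 + 1260*m^8*t^6 + 2310*m^7*t^6 + 2205*m^6*t^6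
    + 1155*m^5*t^6 + 315*m^4*t^6 + 35*m^3*t^6
   else 0)"

section \<open>Verification of the closed form of the moments\<close>

lemma choose_numeral:
  "(numeral k choose numeral l) = numeral k * (pred_numeral k choose pred_numeral l) div numeral l"
  by (metis Suc_times_binomial nonzero_mult_div_cancel_left numeral_eq_Suc zero_neq_numeral)

lemma sum_atMost_numeral:
  fixes f :: "nat \<Rightarrow> real"
  shows "(\<Sum>i\<le>1. f i) = f 0 + f 1"
    and "(\<Sum>i\<le>numeral k. f i) = (\<Sum>i\<le>pred_numeral k. f i) + f (numeral k)"
  by (simp_all add: numeral_eq_Suc)

text \<open>This is \<open>path_moment_rec\<close> with the binomial coefficient divided out: the
  coefficients at the two previous end points are \<open>n / (m + n)\<close> and
  \<open>m / (m + n)\<close> times the one at \<open>(m, n)\<close>. As \<open>m\<close> and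
  \<open>n\<close> are real, each of the sixteen admissible pairs gives a polynomial identity. The
  bound 6 is the weight \<open>p + 2 q\<close> of the monomials in a cubed
  \<open>spread\<close>.\<close>

lemma moment_poly_rec:
  assumes "p + 2 * q \<le> 6"
  shows "(m + n) * moment_poly p q t m n =
    n * (\<Sum>i\<le>p. real (p choose i) * m ^ (p - i) * moment_poly i q t m (n - 1)) +
    m * (\<Sum>i\<le>p. \<Sum>j\<le>q. real (p choose i) * real (q choose j) * (- n) ^ (p - i) *
         (t * m - n) ^ (2 * (q - j)) * moment_poly i j t (m - 1) n)"
proof -
  define step where "step p q \<longleftrightarrow> (m + n) * moment_poly p q t m n =
    n * (\<Sum>i\<le>p. real (p choose i) * m ^ (p - i) * moment_poly i q t m (n - 1)) +
    m * (\<Sum>i\<le>p. \<Sum>j\<le>q. real (p choose i) * real (q choose j) * (- n) ^ (p - i) *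
         (t * m - n) ^ (2 * (q - j)) * moment_poly i j t (m - 1) n)" for p q
  have "step 0 0" and "step 1 0" and "step 2 0" and "step 3 0" and "step 4 0" and "step 5 0" and "step 6 0" and "step 0 1" and "step 1 1" and "step 2 1" and "step 3 1" and "step 4 1" and "step 0 2" and "step 1 2" and "step 2 2" and "step 0 3"
    by (simp add: step_def sum_atMost_numeral moment_poly_def choose_numeral del: power_Suc; algebra?)+
  moreover have "q = 0 \<and> (p = 0 \<or> p = 1 \<or> p = 2 \<or> p = 3 \<or> p = 4 \<or> p = 5 \<or> p = 6) \<or>
    q = 1 \<and> (p = 0 \<or> p = 1 \<or> p = 2 \<or> p = 3 \<or> p = 4) \<or>
    q = 2 \<and> (p = 0 \<or> p = 1 \<or> p = 2) \<or> q = 3 \<and> p = 0"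
    using assms by presburger
  ultimately have "step p q" by blast
  then show ?thesis by (simp only: step_def)
qed

lemma path_moment_eq:
  assumes "p + 2 * q \<le> 6"
  shows "7560 * path_moment p q t m n = real ((m + n) choose n) * moment_poly p q t (real m) (real n)"
  using assms
proof (induction "m + n" arbitrary: m n p q rule: less_induct)
  case less
  show ?case
  proof (cases "m + n = 0")
    case True
    \<comment> \<open>The path \<open>[0]\<close> has area and energy 0, so only the moment with
      \<open>p = q = 0\<close> is nonzero.\<close>
    then have "compositions (Suc m) n = {[0]}"
      by (auto simp: compositions_def length_Suc_conv)
    then show ?thesis
      using True by (auto simp: path_moment_def area_def energy_def moment_poly_def power_0_left)
  next
    case False
    define B where "B = real ((m + n) choose n)"
    let ?N = "\<Sum>i\<le>p. real (p choose i) * real m ^ (p - i) * moment_poly i q t (real m) (real n - 1)"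
    let ?E = "\<Sum>i\<le>p. \<Sum>j\<le>q. real (p choose i) * real (q choose j) * (- real n) ^ (p - i) *
         (t * real m - real n) ^ (2 * (q - j)) * moment_poly i j t (real m - 1) (real n)"
    \<comment> \<open>The factor \<open>m + n\<close> permits absorption: \<open>(m + n) * ((m + n -
      1) choose (n - 1)) = n * ((m + n) choose n)\<close>. For \<open>n = 0\<close> the factor
      \<open>n\<close> removes the term with the real, hence negative, argument
      \<open>n - 1\<close>.\<close>
    have N: "(m + n) * (7560 * (if n = 0 then 0 else
         \<Sum>i\<le>p. real (p choose i) * real m ^ (p - i) * path_moment i q t m (n - 1))) = B * (n * ?N)"
    proof (cases n)
      case (Suc n')
      have IH: "7560 * path_moment i q t m n' =
          real ((m + n') choose n') * moment_poly i q t (real m) (real n - 1)" if "i \<le> p" for i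
        using less(1)[of m n' i q] less(2) that Suc by simp
      have "7560 * (\<Sum>i\<le>p. real (p choose i) * real m ^ (p - i) * path_moment i q t m n') =
          (\<Sum>i\<le>p. real (p choose i) * real m ^ (p - i) * (7560 * path_moment i q t m n'))"
        by (simp add: sum_distrib_left mult_ac)
      also have "\<dots> = real ((m + n') choose n') * ?N"
        unfolding sum_distrib_left by (intro sum.cong refl) (subst IH, simp_all add: mult_ac)
      finally have "7560 * (\<Sum>i\<le>p. real (p choose i) * real m ^ (p - i) * path_moment i q t m n') =
          real ((m + n') choose n') * ?N" .
      moreover have "(m + n) * ((m + n') choose n') = n * ((m + n) choose n)"
        using Suc_times_binomial[of n' "m + n'"] Suc by (simp del: binomial_Suc_Suc)
      then have "real (m + n) * real ((m + n') choose n') = real n * B"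
        unfolding B_def of_nat_mult[symmetric] by simp
      ultimately show ?thesis
        using Suc by (simp add: mult.assoc[symmetric])
    qed simp
    have E: "(m + n) * (7560 * (if m = 0 then 0 else
         \<Sum>i\<le>p. \<Sum>j\<le>q. real (p choose i) * real (q choose j) * (- real n) ^ (p - i) *
         (t * real m - real n) ^ (2 * (q - j)) * path_moment i j t (m - 1) n)) = B * (m * ?E)"
    proof (cases m)
      case (Suc m')
      have IH: "7560 * path_moment i j t m' n =
          real ((m' + n) choose n) * moment_poly i j t (real m - 1) (real n)" if "i \<le> p" "j \<le> q" for i j
        using less(1)[of m' n i j] less(2) that Suc by simp
      have "7560 * (\<Sum>i\<le>p. \<Sum>j\<le>q. real (p choose i) * real (q choose j) * (- real n) ^ (p - i) *
         (t * real m - real n) ^ (2 * (q - j)) * path_moment i j t m' n) =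
        (\<Sum>i\<le>p. \<Sum>j\<le>q. real (p choose i) * real (q choose j) * (- real n) ^ (p - i) *
         (t * real m - real n) ^ (2 * (q - j)) * (7560 * path_moment i j t m' n))"
        by (simp add: sum_distrib_left mult_ac)
      also have "\<dots> = real ((m' + n) choose n) * ?E"
        unfolding sum_distrib_left by (intro sum.cong refl) (subst IH, simp_all add: mult_ac)
      finally have "7560 * (\<Sum>i\<le>p. \<Sum>j\<le>q. real (p choose i) * real (q choose j) * (- real n) ^ (p - i) *
         (t * real m - real n) ^ (2 * (q - j)) * path_moment i j t m' n) =
         real ((m' + n) choose n) * ?E" .
      moreover have "(m + n) * ((m' + n) choose n) = m * ((m + n) choose n)"
        using Suc_times_binomial[of m' "m' + n"] binomial_symmetric[of n "m' + n"]
          binomial_symmetric[of n "m + n"] Suc by (simp del: binomial_Suc_Suc)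
      then have "real (m + n) * real ((m' + n) choose n) = real m * B"
        unfolding B_def of_nat_mult[symmetric] by simp
      ultimately show ?thesis
        using Suc by (simp add: mult.assoc[symmetric])
    qed simp
    have "real (m + n) * (7560 * path_moment p q t m n) =
        B * (real n * ?N + real m * ?E)"
      using path_moment_rec[of m n p q t] False N E by (simp add: distrib_left)
    also have "\<dots> = real (m + n) * (B * moment_poly p q t (real m) (real n))"
      using moment_poly_rec[OF less(2), of "real m" "real n" t] by simp
    finally show ?thesis
      using False by (simp add: B_def)
  qed
qed

section \<open>Third central moment over all weak compositions\<close>

text \<open>At the slope of the chord \<open>area z\<close> is twice the sum of the deviations
  \<open>d_j\<close>, so this is half of \<open>a * (sum of d_j^2) - (sum of d_j)^2\<close> with
  \<open>a = length z\<close>, a multiple of their variance.\<close>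

definition spread :: "real \<Rightarrow> nat list \<Rightarrow> real" where
  "spread t z = (real (length z) * energy t z - area z ^ 2 / 4) / 2"

lemma third_central_moment_spread:
  fixes a b :: nat
  assumes "0 < a"
  defines "N \<equiv> real (card (compositions a b))" and "f \<equiv> spread (real b / real a)"
  defines "\<mu> \<equiv> (\<Sum>z\<in>compositions a b. f z) / N"
  shows "(\<Sum>z\<in>compositions a b. (f z - \<mu>) ^ 3) / N =
    real a * real b * (real a - 1) * (real b - 1) * (real a + real b) * (real a + real b + 1) *
      (2 * real a ^ 2 * real b - 3 * real a ^ 2 + 2 * real a * real b ^ 2
        - 3 * real a * real b - 3 * real b ^ 2 - 3) / 60480"
proof -
  \<comment> \<open>Replacing \<open>b\<close> by \<open>t * A\<close> keeps everything polynomial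
    in \<open>A\<close> and \<open>t\<close>, so the closing identity needs no division by
    \<open>a\<close>.\<close>
  define t m A where "t = real b / real a" and "m = a - 1" and "A = real a"
  have a: "a = Suc m" and m: "real m = A - 1" and b: "real b = t * A"
    using assms(1) by (simp_all add: m_def t_def A_def)
  define Q where "Q p q = moment_poly p q t (A - 1) (t * A)" for p q
  have N: "N = real ((m + b) choose b)" "N > 0"
    unfolding N_def compositions_def using card_length_sum_list[of a b] a by (simp_all add: add.commute)
  have M: "path_moment p q t m b = N * Q p q / 7560" if "p + 2 * q \<le> 6" for p q
    using path_moment_eq[OF that, of t m b] N m b by (simp add: Q_def field_simps)
  \<comment> \<open>The first three raw moments of \<open>f\<close>: powers of
    \<open>A / 2 * energy - area^2 / 8\<close> are expanded and each joint moment is replaced by its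
    polynomial over 7560.\<close>
  define s1 s2 s3 where "s1 = (A / 2 * Q 0 1 - Q 2 0 / 8) / 7560"
    and "s2 = (A^2 / 4 * Q 0 2 - A / 8 * Q 2 1 + Q 4 0 / 64) / 7560"
    and "s3 = (A^3 / 8 * Q 0 3 - 3 * A^2 / 32 * Q 2 2 + 3 * A / 128 * Q 4 1 - Q 6 0 / 512) / 7560"
  have f: "f z = A / 2 * energy t z - area z ^ 2 / 8" if "z \<in> compositions a b" for z
    using that by (simp add: f_def spread_def compositions_def A_def t_def field_simps)
  have S1: "(\<Sum>z\<in>compositions a b. f z) = N * s1"
  proof -
    have "(\<Sum>z\<in>compositions a b. f z) =
      (\<Sum>z\<in>compositions a b. A / 2 * (area z ^ 0 * energy t z ^ 1) - 1 / 8 * (area z ^ 2 * energy t z ^ 0))"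
      by (intro sum.cong refl) (simp add: f)
    also have "\<dots> = A / 2 * path_moment 0 1 t m b - 1 / 8 * path_moment 2 0 t m b"
      unfolding path_moment_def a sum_subtractf sum_distrib_left ..
    finally show ?thesis by (simp add: M s1_def field_simps)
  qed
  have S2: "(\<Sum>z\<in>compositions a b. f z ^ 2) = N * s2"
  proof -
    have "(\<Sum>z\<in>compositions a b. f z ^ 2) =
      (\<Sum>z\<in>compositions a b. A^2 / 4 * (area z ^ 0 * energy t z ^ 2) -
         A / 8 * (area z ^ 2 * energy t z ^ 1) + 1 / 64 * (area z ^ 4 * energy t z ^ 0))"
      by (intro sum.cong refl) (simp add: f field_simps eval_nat_numeral)
    also have "\<dots> = A^2 / 4 * path_moment 0 2 t m b - A / 8 * path_moment 2 1 t m b +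
         1 / 64 * path_moment 4 0 t m b"
      unfolding path_moment_def a sum_subtractf sum.distrib sum_distrib_left ..
    finally show ?thesis by (simp add: M s2_def field_simps)
  qed
  have S3: "(\<Sum>z\<in>compositions a b. f z ^ 3) = N * s3"
  proof -
    have "(\<Sum>z\<in>compositions a b. f z ^ 3) =
      (\<Sum>z\<in>compositions a b. A^3 / 8 * (area z ^ 0 * energy t z ^ 3) -
         3 * A^2 / 32 * (area z ^ 2 * energy t z ^ 2) + 3 * A / 128 * (area z ^ 4 * energy t z ^ 1) -
         1 / 512 * (area z ^ 6 * energy t z ^ 0))"
      by (intro sum.cong refl) (simp add: f field_simps eval_nat_numeral)
    also have "\<dots> = A^3 / 8 * path_moment 0 3 t m b - 3 * A^2 / 32 * path_moment 2 2 t m b +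
         3 * A / 128 * path_moment 4 1 t m b - 1 / 512 * path_moment 6 0 t m b"
      unfolding path_moment_def a sum_subtractf sum.distrib sum_distrib_left ..
    finally show ?thesis by (simp add: M s3_def field_simps)
  qed
  have mu: "\<mu> = s1"
    using N(2) by (simp add: \<mu>_def S1)
  have "(\<Sum>z\<in>compositions a b. (f z - \<mu>) ^ 3) =
    (\<Sum>z\<in>compositions a b. f z ^ 3 - 3 * s1 * f z ^ 2 + 3 * s1 ^ 2 * f z - s1 ^ 3)"
    unfolding mu by (intro sum.cong refl) algebra
  also have "\<dots> = N * s3 - 3 * s1 * (N * s2) + 3 * s1 ^ 2 * (N * s1) - N * s1 ^ 3"
    unfolding S1[symmetric] S2[symmetric] S3[symmetric]
    by (simp add: sum_subtractf sum.distrib sum_distrib_left N_def)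
  also have "\<dots> = N * (s3 - 3 * s1 * s2 + 2 * s1 ^ 3)"
    by algebra
  finally have "(\<Sum>z\<in>compositions a b. (f z - \<mu>) ^ 3) / N = s3 - 3 * s1 * s2 + 2 * s1 ^ 3"
    using N(2) by simp
  also have "\<dots> = A * (t * A) * (A - 1) * (t * A - 1) * (A + t * A) * (A + t * A + 1) *
      (2 * A ^ 2 * (t * A) - 3 * A ^ 2 + 2 * A * (t * A) ^ 2
        - 3 * A * (t * A) - 3 * (t * A) ^ 2 - 3) / 60480"
    unfolding s1_def s2_def s3_def Q_def
    by (simp add: moment_poly_def, algebra)
  finally show ?thesis
    unfolding b by (simp only: A_def)
qed

section \<open>Rotations and Dyck paths\<close>

text \<open>Indices are reduced modulo the length: \<open>z\<close> is read periodically, and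
  rotation becomes a shift of the index.\<close>

definition psum :: "nat list \<Rightarrow> nat \<Rightarrow> nat" where
  "psum z j = (\<Sum>i<j. z ! (i mod length z))"

text \<open>The deviation from the chord, scaled by \<open>length z\<close> to be an integer; these
  are the \<open>y\<close> of the introduction.\<close>

definition height :: "nat \<Rightarrow> nat list \<Rightarrow> nat \<Rightarrow> int" where
  "height b z j = int (j * b) - int (length z * psum z j)"

definition dyck :: "nat \<Rightarrow> nat \<Rightarrow> nat list set" where
  "dyck a b = {z \<in> compositions a b. \<forall>j. 0 \<le> height b z j}"

lemma psum_eq_take:
  assumes "j \<le> length z"
  shows "psum z j = sum_list (take j z)"
  using assms by (auto simp: psum_def sum_list_sum_nth min_def atLeast0LessThan intro!: sum.cong)

lemma height_0 [simp]: "height b z 0 = 0"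
  by (simp add: height_def psum_def)

lemma height_Suc:
  "height b z (Suc j) = height b z j + int b - int (length z) * int (z ! (j mod length z))"
  by (simp add: height_def psum_def algebra_simps)

lemma psum_add_length:
  assumes "z \<in> compositions a b"
  shows "psum z (j + a) = psum z j + b"
proof (induction j)
  case 0
  then show ?case
    using assms psum_eq_take[of a z] by (simp add: compositions_def psum_def)
next
  case (Suc j)
  then show ?case
    using assms by (simp add: psum_def compositions_def)
qed

lemma height_add_length:
  assumes "z \<in> compositions a b"
  shows "height b z (j + a) = height b z j"
  using psum_add_length[OF assms, of j] assms
  by (simp add: height_def compositions_def algebra_simps)

lemma height_add_mult_length:
  assumes "z \<in> compositions a b"
  shows "height b z (j + k * a) = height b z j"
proof (induction k)
  case (Suc k)
  then show ?case
    using height_add_length[OF assms, of "j + k * a"] by (simp add: algebra_simps)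
qed simp

lemma height_mod_length:
  assumes "z \<in> compositions a b"
  shows "height b z (j mod a) = height b z j"
  using height_add_mult_length[OF assms, of "j mod a" "j div a"] by simp

text \<open>The other term of \<open>height\<close> is a multiple of \<open>a\<close>. For coprime
  \<open>a\<close>, \<open>b\<close> the heights in one period are therefore pairwise
  distinct.\<close>

lemma height_mod:
  assumes "z \<in> compositions a b"
  shows "height b z j mod int a = int (j * b mod a)"
proof -
  have "height b z j = int (j * b) - int a * int (psum z j)"
    using assms by (simp add: height_def compositions_def)
  then show ?thesis
    by (simp add: zmod_int mod_diff_eq[symmetric, of _ "int a * _"])
qed

lemma rotate_mem_compositions [simp]: "rotate r z \<in> compositions a b \<longleftrightarrow> z \<in> compositions a b"
proof -
  have "sum_list (rotate1 z) = sum_list z" for z :: "nat list"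
    by (cases z) simp_all
  then have "sum_list (rotate r z) = sum_list z"
    by (induction r) simp_all
  then show ?thesis by (simp add: compositions_def)
qed

lemma psum_rotate:
  assumes "z \<noteq> []"
  shows "psum (rotate r z) j + psum z r = psum z (r + j)"
proof (induction j)
  case (Suc j)
  have "rotate r z ! (j mod length z) = z ! ((r + j) mod length z)"
    using assms by (simp add: nth_rotate mod_add_right_eq)
  then show ?case using Suc by (simp add: psum_def)
qed (simp add: psum_def)

text \<open>Rotation moves the origin to position \<open>r\<close> of the periodic path.\<close>

lemma height_rotate:
  assumes "z \<noteq> []"
  shows "height b (rotate r z) j = height b z (r + j) - height b z r"
proof -
  have "int (psum z (r + j)) = int (psum (rotate r z) j) + int (psum z r)"
    using psum_rotate[OF assms, of r j] by simp
  then show ?thesis by (simp add: height_def algebra_simps)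
qed

lemma sum_periodic_shift:
  fixes g :: "nat \<Rightarrow> real"
  assumes "\<And>j. g (j + a) = g j"
  shows "(\<Sum>j<a. g (r + j)) = (\<Sum>j<a. g j)"
proof (induction r)
  case (Suc r)
  have "(\<Sum>j<a. g (Suc r + j)) + g r = (\<Sum>j<Suc a. g (r + j))"
    by (subst sum.lessThan_Suc_shift) simp
  then show ?case using Suc assms by simp
qed simp

text \<open>Heights are \<open>a\<close> times the deviations \<open>d_j\<close>, and at slope
  \<open>b / a\<close> the chord contributes \<open>b * (a - 1) / 2\<close> to the sum of the
  \<open>d_j\<close>, as in \<open>area\<close>. The right side is half the variance of the heights
  over one period.\<close>

lemma spread_eq_heights:
  assumes z: "z \<in> compositions a b" and "0 < a"
  shows "spread (real b / real a) z =
    ((\<Sum>j<a. real_of_int (height b z j) ^ 2) / a - (\<Sum>j<a. real_of_int (height b z j)) ^ 2 / a^2) / 2"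
proof -
  define d where "d j = real b / real a * real j - real (sum_list (take j z))" for j
  have len: "length z = a" and sum: "sum_list z = b"
    using z by (auto simp: compositions_def)
  have h: "real_of_int (height b z j) = a * d j" if "j < a" for j
    using that len \<open>0 < a\<close> by (simp add: height_def d_def psum_eq_take field_simps)
  define G where "G = (\<Sum>j<a. real j)"
  have G: "G = real a * (real a - 1) / 2"
    unfolding G_def by (induction a) (simp_all add: field_simps)
  have "2 * (real b / real a * G) = real b * (real a - 1)"
    unfolding G using \<open>0 < a\<close> by simp
  then have "2 * (\<Sum>j<a. d j) = real b * (real a - 1) - 2 * (\<Sum>j<a. real (sum_list (take j z)))"
    unfolding d_def sum_subtractf sum_distrib_left[symmetric] G_def[symmetric] by simp
  then have area: "area z = 2 * (\<Sum>j<a. d j)"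
    by (simp add: area_def len sum)
  have energy: "energy (real b / real a) z = (\<Sum>j<a. d j ^ 2)"
    by (simp add: energy_def d_def len)
  have "(\<Sum>j<a. real_of_int (height b z j) ^ 2) = a^2 * (\<Sum>j<a. d j ^ 2)"
    unfolding sum_distrib_left by (intro sum.cong) (simp_all add: h power_mult_distrib)
  moreover have "(\<Sum>j<a. real_of_int (height b z j)) = a * (\<Sum>j<a. d j)"
    unfolding sum_distrib_left by (intro sum.cong) (simp_all add: h)
  ultimately show ?thesis
    using \<open>0 < a\<close> by (simp add: spread_def len area energy field_simps power2_eq_square)
qed

text \<open>A variance ignores both effects of rotation on the heights: the cyclic shift and the
  subtracted constant.\<close>

lemma spread_rotate:
  assumes z: "z \<in> compositions a b" and "0 < a"
  shows "spread (real b / real a) (rotate r z) = spread (real b / real a) z"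
proof -
  define Y where "Y j = real_of_int (height b z j)" for j
  define c where "c = Y r"
  have "z \<noteq> []" using assms by (auto simp: compositions_def)
  then have Yr: "real_of_int (height b (rotate r z) j) = Y (r + j) - c" for j
    by (simp add: height_rotate Y_def c_def)
  have per: "Y (j + a) = Y j" for j
    by (simp add: Y_def height_add_length[OF z])
  have shift: "(\<Sum>j<a. Y (r + j)) = (\<Sum>j<a. Y j)" "(\<Sum>j<a. Y (r + j) ^ 2) = (\<Sum>j<a. Y j ^ 2)"
    using sum_periodic_shift[of Y a r] sum_periodic_shift[of "\<lambda>j. Y j ^ 2" a r] per by simp_all
  have "(\<Sum>j<a. (Y (r + j) - c) ^ 2) = (\<Sum>j<a. Y (r + j) ^ 2 - 2 * c * Y (r + j) + c^2)"
    by (intro sum.cong) (simp_all add: power2_diff)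
  also have "\<dots> = (\<Sum>j<a. Y j ^ 2) - 2 * c * (\<Sum>j<a. Y j) + a * c^2"
    by (simp add: sum.distrib sum_subtractf shift flip: sum_distrib_left)
  finally have sq: "(\<Sum>j<a. (Y (r + j) - c) ^ 2) = (\<Sum>j<a. Y j ^ 2) - 2 * c * (\<Sum>j<a. Y j) + a * c^2" .
  have lin: "(\<Sum>j<a. Y (r + j) - c) = (\<Sum>j<a. Y j) - a * c"
    by (simp add: sum_subtractf shift)
  have "spread (real b / real a) (rotate r z) =
      ((\<Sum>j<a. (Y (r + j) - c) ^ 2) / a - (\<Sum>j<a. Y (r + j) - c) ^ 2 / a^2) / 2"
    using z \<open>0 < a\<close> by (subst spread_eq_heights) (simp_all add: Yr)
  also have "\<dots> = ((\<Sum>j<a. Y j ^ 2) / a - (\<Sum>j<a. Y j) ^ 2 / a^2) / 2"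
    unfolding sq lin using \<open>0 < a\<close> by (simp add: field_simps power2_eq_square)
  also have "\<dots> = spread (real b / real a) z"
    using spread_eq_heights[OF z \<open>0 < a\<close>] by (simp add: Y_def)
  finally show ?thesis .
qed

section \<open>The cycle lemma\<close>

lemma bij_betw_mult_mod:
  fixes a b :: nat
  assumes "coprime a b" "0 < a"
  shows "bij_betw (\<lambda>j. j * b mod a) {..<a} {..<a}"
proof -
  have "inj_on (\<lambda>j. j * b mod a) {..<a}"
  proof (rule inj_onI)
    fix i j assume "i \<in> {..<a}" "j \<in> {..<a}" "i * b mod a = j * b mod a"
    then have "[i = j] (mod a)"
      using assms cong_mult_rcancel_nat[of b a i j] by (simp add: cong_def coprime_commute)
    then show "i = j" using \<open>i \<in> _\<close> \<open>j \<in> _\<close> by (simp add: cong_def)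
  qed
  then show ?thesis
    using assms by (intro bij_betw_imageI endo_inj_surj) auto
qed

lemma rotate_mem_dyck_iff:
  assumes z: "z \<in> compositions a b" and "0 < a"
  shows "rotate r z \<in> dyck a b \<longleftrightarrow> (\<forall>j. height b z r \<le> height b z j)"
proof -
  have "z \<noteq> []" using assms by (auto simp: compositions_def)
  have "height b z r \<le> height b z j" if "\<forall>j. height b z r \<le> height b z (r + j)" for j
  proof -
    \<comment> \<open>Moving \<open>j\<close> on by \<open>r\<close> periods makes it at least
      \<open>r\<close>, so it has the form \<open>r + i\<close>.\<close>
    have "r \<le> j + r * a" using \<open>0 < a\<close> by (cases a) auto
    then have "height b z r \<le> height b z (j + r * a)"
      using that[rule_format, of "j + r * a - r"] by simp
    then show ?thesis by (simp add: height_add_mult_length[OF z])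
  qed
  then show ?thesis
    using z \<open>z \<noteq> []\<close> by (auto simp: dyck_def height_rotate)
qed

text \<open>A Dyck rotation starts where the height is minimal; by coprimality the heights in one
  period are distinct modulo \<open>a\<close>, so this place is unique.\<close>

lemma ex1_rotate_dyck:
  assumes z: "z \<in> compositions a b" and "0 < a" "coprime a b"
  shows "\<exists>!r. r < a \<and> rotate r z \<in> dyck a b"
proof (rule ex_ex1I)
  obtain r where r: "r < a" "\<And>j. j < a \<Longrightarrow> height b z r \<le> height b z j"
    using ex_is_arg_min_if_finite[of "{..<a}" "height b z"] \<open>0 < a\<close>
    by (auto simp: is_arg_min_linorder)
  have "height b z r \<le> height b z j" for j
    using r(2)[of "j mod a"] \<open>0 < a\<close> by (simp add: height_mod_length[OF z])
  then show "\<exists>r. r < a \<and> rotate r z \<in> dyck a b"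
    using r(1) rotate_mem_dyck_iff[OF z \<open>0 < a\<close>] by blast
next
  fix r s assume rs: "r < a \<and> rotate r z \<in> dyck a b" "s < a \<and> rotate s z \<in> dyck a b"
  then have "height b z r = height b z s"
    using rotate_mem_dyck_iff[OF z \<open>0 < a\<close>] by (meson order_antisym)
  then have "r * b mod a = s * b mod a"
    using height_mod[OF z, of r] height_mod[OF z, of s] by simp
  then show "r = s"
    using bij_betw_mult_mod[OF \<open>coprime a b\<close> \<open>0 < a\<close>] rs
    by (auto simp: bij_betw_def dest: inj_onD)
qed

text \<open>The pairs \<open>(z, r)\<close> with \<open>rotate r z\<close> Dyck are counted twice:
  each \<open>z\<close> has exactly one such \<open>r\<close>, while for fixed \<open>r\<close>
  rotation permutes the compositions. Counting indices \<open>r\<close> avoids any discussion of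
  orbit sizes.\<close>

lemma sum_compositions_eq_dyck:
  fixes f :: "nat list \<Rightarrow> real"
  assumes "0 < a" "coprime a b"
    and rot: "\<And>r z. z \<in> compositions a b \<Longrightarrow> f (rotate r z) = f z"
  shows "(\<Sum>z\<in>compositions a b. f z) = a * (\<Sum>z\<in>dyck a b. f z)"
proof -
  have inj: "inj (rotate r :: nat list \<Rightarrow> nat list)" for r
    unfolding rotate_def by (rule inj_fn[OF inj_rotate1])
  have image: "rotate r ` compositions a b = compositions a b" for r
    by (intro endo_inj_surj finite_compositions inj_on_subset[OF inj]) auto
  have "(\<Sum>z\<in>compositions a b. f z) =
      (\<Sum>z\<in>compositions a b. \<Sum>r<a. if rotate r z \<in> dyck a b then f (rotate r z) else 0)"
  proof (intro sum.cong refl)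
    fix z assume z: "z \<in> compositions a b"
    obtain s where "s < a" "\<And>r. r < a \<Longrightarrow> rotate r z \<in> dyck a b \<longleftrightarrow> r = s"
      using ex1_rotate_dyck[OF z assms(1,2)] by blast
    then have "(\<Sum>r<a. if rotate r z \<in> dyck a b then f (rotate r z) else 0) =
        (\<Sum>r<a. if r = s then f z else 0)"
      using rot[OF z] by (intro sum.cong) auto
    then show "f z = (\<Sum>r<a. if rotate r z \<in> dyck a b then f (rotate r z) else 0)"
      using \<open>s < a\<close> by simp
  qed
  also have "\<dots> = (\<Sum>r<a. \<Sum>z\<in>compositions a b. if rotate r z \<in> dyck a b then f (rotate r z) else 0)"
    by (rule sum.swap)
  also have "\<dots> = (\<Sum>r<a. \<Sum>z\<in>compositions a b. if z \<in> dyck a b then f z else 0)"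
  proof (rule sum.cong[OF refl])
    fix r
    show "(\<Sum>z\<in>compositions a b. if rotate r z \<in> dyck a b then f (rotate r z) else 0) =
        (\<Sum>z\<in>compositions a b. if z \<in> dyck a b then f z else 0)"
      using sum.reindex[OF inj_on_subset[OF inj subset_UNIV],
          of "\<lambda>z. if z \<in> dyck a b then f z else 0" r "compositions a b"]
      by (simp add: image)
  qed
  also have "(\<Sum>z\<in>compositions a b. if z \<in> dyck a b then f z else 0) = (\<Sum>z\<in>dyck a b. f z)"
    by (intro sum.mono_neutral_cong_right finite_compositions) (auto simp: dyck_def)
  finally show ?thesis by simp
qed

section \<open>Beta numbers\<close>

text \<open>For a partition these are the hook lengths in the first column.\<close>

primrec beta_set :: "nat list \<Rightarrow> nat set" where
  "beta_set [] = {}"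
| "beta_set (x # xs) = insert (x + length xs) (beta_set xs)"

lemma beta_set_eq_image: "beta_set l = (\<lambda>i. l ! i + (length l - Suc i)) ` {..<length l}"
  by (induction l) (simp_all add: lessThan_Suc_eq_insert_0 image_image del: lessThan_Suc)

lemma finite_beta_set [simp]: "finite (beta_set l)"
  by (induction l) simp_all

lemma is_partition_Cons:
  "is_partition (x # xs) \<longleftrightarrow> 0 < x \<and> (\<forall>y\<in>set xs. y \<le> x) \<and> is_partition xs"
  by (auto simp: is_partition_def)

lemma beta_set_less:
  assumes "is_partition (x # xs)" "y \<in> beta_set xs"
  shows "y < x + length xs"
proof -
  obtain i where i: "i < length xs" "y = xs ! i + (length xs - Suc i)"
    using assms(2) by (auto simp: beta_set_eq_image)
  moreover have "xs ! i \<le> x"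
    using i(1) assms(1) by (simp add: is_partition_Cons)
  ultimately show ?thesis by linarith
qed

lemma card_beta_set:
  assumes "is_partition l"
  shows "card (beta_set l) = length l"
  using assms
proof (induction l)
  case (Cons x xs)
  then have "x + length xs \<notin> beta_set xs"
    using beta_set_less by blast
  with Cons show ?case by (simp add: is_partition_Cons)
qed simp

lemma zero_notin_beta_set:
  assumes "is_partition l"
  shows "0 \<notin> beta_set l"
  using assms by (induction l) (simp_all add: is_partition_Cons)

text \<open>From bottom to top, the beta numbers exceed the parts by
  \<open>0, ..., length l - 1\<close>.\<close>

lemma sum_beta_set:
  assumes "is_partition l"
  shows "2 * (\<Sum>x\<in>beta_set l. real x) =
    2 * real (partition_size l) + real (length l) * (real (length l) - 1)"
  using assms
proof (induction l)
  case (Cons x xs)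
  then have "x + length xs \<notin> beta_set xs"
    using beta_set_less by blast
  with Cons show ?case by (simp add: is_partition_Cons partition_size_def algebra_simps)
qed (simp add: partition_size_def)

text \<open>The cardinality gives the length, then the maximum gives the first part; removing the
  maximum leaves the beta numbers of the tail.\<close>

lemma inj_on_beta_set: "inj_on beta_set {l. is_partition l}"
proof -
  have "l = k" if "is_partition l" "is_partition k" "beta_set l = beta_set k" for l k
    using that
  proof (induction l arbitrary: k)
    case Nil
    then show ?case by (cases k) simp_all
  next
    case (Cons x xs)
    obtain y ys where k: "k = y # ys"
      using Cons.prems by (cases k) simp_all
    have len: "length xs = length ys"
      using Cons.prems card_beta_set[of "x # xs"] card_beta_set[of k] k by simp
    have "Max (beta_set (x # xs)) = x + length xs"
      using beta_set_less[OF Cons.prems(1)] by (intro Max_eqI) (auto intro: less_imp_le)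
    moreover have "Max (beta_set k) = y + length ys"
      unfolding k using beta_set_less[of y ys] Cons.prems(2) k
      by (intro Max_eqI) (auto intro: less_imp_le)
    ultimately have "x = y"
      using Cons.prems(3) len by simp
    have "beta_set xs = beta_set ys"
    proof -
      have "beta_set xs = beta_set (x # xs) - {x + length xs}"
        using beta_set_less[OF Cons.prems(1)] by auto
      also have "\<dots> = beta_set (y # ys) - {y + length ys}"
        using Cons.prems(3) k len \<open>x = y\<close> by simp
      also have "\<dots> = beta_set ys"
        using beta_set_less[of y ys] Cons.prems(2) k by auto
      finally show ?thesis .
    qed
    then show ?case
      using Cons.IH[of ys] Cons.prems k \<open>x = y\<close> by (simp add: is_partition_Cons)
  qed
  then show ?thesis by (simp add: inj_on_def)
qed

text \<open>The partition is built from the bottom: a new maximum \<open>m\<close> becomes a new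
  first part \<open>m - length l\<close>.\<close>

lemma ex_partition_beta_set:
  assumes "finite X" "0 \<notin> X"
  shows "\<exists>l. is_partition l \<and> beta_set l = X"
  using assms
proof (induction X rule: finite_linorder_max_induct)
  case empty
  then show ?case by (intro exI[of _ "[]"]) (simp add: is_partition_def)
next
  case (insert m X)
  then obtain l where l: "is_partition l" "beta_set l = X" by auto
  have "0 < m" using insert.prems by (cases m) auto
  \<comment> \<open>The largest beta number of a nonempty \<open>l\<close> is
    \<open>hd l + length l - 1\<close>, and it is less than \<open>m\<close>; hence the new part is
    at least \<open>hd l\<close>.\<close>
  have bound: "length l + (if l = [] then 0 else hd l) \<le> m"
  proof (cases l)
    case (Cons y ys)
    then have "y + length ys \<in> X" using l(2) by auto
    then show ?thesis using insert.hyps(2) Cons by force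
  qed simp
  have "\<forall>y\<in>set l. y \<le> hd l"
    using l(1) by (cases l) (auto simp: is_partition_def)
  moreover have "length l < m"
  proof (cases l)
    case (Cons y ys)
    then have "0 < hd l" using l(1) by (simp add: is_partition_Cons)
    then show ?thesis using bound Cons by simp
  qed (simp add: \<open>0 < m\<close>)
  ultimately have "is_partition ((m - length l) # l)"
    using bound l(1) by (cases l) (force simp: is_partition_Cons)+
  moreover have "beta_set ((m - length l) # l) = insert m X"
    using l(2) \<open>length l < m\<close> by simp
  ultimately show ?case by blast
qed

section \<open>Hook lengths in terms of beta numbers\<close>

lemma initial_segment_eq:
  fixes S :: "nat set"
  assumes "finite S" "\<And>x y. x \<in> S \<Longrightarrow> y < x \<Longrightarrow> y \<in> S"
  shows "S = {..<card S}"
proof -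
  define n where "n = (LEAST n. n \<notin> S)"
  have "\<exists>n. n \<notin> S" using assms(1) infinite_UNIV_nat by (metis UNIV_eq_I)
  then have "n \<notin> S" unfolding n_def by (rule LeastI_ex)
  moreover have "x \<in> S" if "x < n" for x
    using that not_less_Least unfolding n_def by blast
  ultimately have "S = {..<n}"
    using assms(2) by (metis (no_types, lifting) lessThan_iff linorder_neqE_nat set_eqI)
  then show ?thesis by simp
qed

text \<open>Part \<open>j\<close> of the conjugate partition.\<close>

definition col :: "nat list \<Rightarrow> nat \<Rightarrow> nat" where
  "col l j = card {r. r < length l \<and> j < l ! r}"

lemma partition_nth_antimono:
  assumes "is_partition l" "i \<le> k" "k < length l"
  shows "l ! k \<le> l ! i"
  using assms sorted_wrt_nth_less[of "(\<ge>)" l i k]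
  by (cases "i = k") (auto simp: is_partition_def)

lemma less_col_iff:
  assumes "is_partition l"
  shows "r < col l j \<longleftrightarrow> r < length l \<and> j < l ! r"
proof -
  have "{r. r < length l \<and> j < l ! r} = {..<col l j}"
    unfolding col_def using partition_nth_antimono[OF assms]
    by (intro initial_segment_eq) (auto intro: less_le_trans less_imp_le)
  then show ?thesis by blast
qed

text \<open>The row contributes \<open>l ! i - j\<close> boxes, corner included, and the column
  \<open>col l j - Suc i\<close> more; the additive form avoids truncated subtraction.\<close>

lemma hook_length_eq:
  assumes "is_partition l" "i < length l" "j < l ! i"
  shows "hook_length l (i, j) + j + Suc i = l ! i + col l j"
proof -
  have i: "i < col l j" using assms by (simp add: less_col_iff)
  have "hook l (i, j) = Pair i ` {j..<l ! i} \<union> (\<lambda>r. (r, j)) ` {Suc i..<col l j}"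
    using assms less_col_iff[OF assms(1)]
    by (auto simp: hook_def ferrers_def image_iff Suc_le_eq less_le)
  moreover have "card (Pair i ` {j..<l ! i} \<union> (\<lambda>r. (r, j)) ` {Suc i..<col l j}) =
      (l ! i - j) + (col l j - Suc i)"
    by (subst card_Un_disjoint) (auto simp: card_image inj_on_def)
  ultimately show ?thesis
    using assms(3) i by (simp add: hook_length_def)
qed

text \<open>The hook lengths in the row of a beta number \<open>x\<close> are the distances from \<open>x\<close> down to the gaps
  below it; column \<open>j\<close> corresponds to the gap \<open>j + length l - col l j\<close>.\<close>

lemma no_hook_dvd_iff:
  assumes l: "is_partition l"
  shows "(\<forall>c\<in>ferrers l. \<not> a dvd hook_length l c) \<longleftrightarrow>
    (\<forall>x\<in>beta_set l. \<forall>y<x. y \<notin> beta_set l \<longrightarrow> \<not> a dvd x - y)"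
proof
  define n where "n = length l"
  define \<beta> where "\<beta> i = l ! i + (n - Suc i)" for i
  have beta: "beta_set l = \<beta> ` {..<n}"
    by (simp add: beta_set_eq_image \<beta>_def n_def)
  have anti: "l ! k \<le> l ! i" if "i \<le> k" "k < n" for i k
    using partition_nth_antimono[OF l] that by (simp add: n_def)
  {
    assume hooks: "\<forall>c\<in>ferrers l. \<not> a dvd hook_length l c"
    show "\<forall>x\<in>beta_set l. \<forall>y<x. y \<notin> beta_set l \<longrightarrow> \<not> a dvd x - y"
    proof (intro ballI allI impI)
      fix x y assume x: "x \<in> beta_set l" and "y < x" and y: "y \<notin> beta_set l"
      then obtain i where i: "i < n" "x = \<beta> i" by (auto simp: beta)
      \<comment> \<open>The rows whose beta number exceeds the gap \<open>y\<close> come first;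
        their number \<open>r\<close> will be the length of the column belonging to
        \<open>y\<close>.\<close>
      define r where "r = card {k. k < n \<and> y < \<beta> k}"
      have "{k. k < n \<and> y < \<beta> k} = {..<r}"
        unfolding r_def
      proof (rule initial_segment_eq)
        fix p q assume "p \<in> {k. k < n \<and> y < \<beta> k}" "q < p"
        then show "q \<in> {k. k < n \<and> y < \<beta> k}"
          using anti[of q p] by (auto simp: \<beta>_def)
      qed simp
      then have r: "k < r \<longleftrightarrow> k < n \<and> y < \<beta> k" for k by blast
      have "r \<le> n" using r[of n] by linarith
      have "i < r" using r i \<open>y < x\<close> by simp
      \<comment> \<open>The gap lies strictly between the beta numbers of rows \<open>r\<close> and
        \<open>r - 1\<close>, so \<open>j = y - (n - r)\<close> satisfies
        \<open>l ! r \<le> j < l ! (r - 1)\<close>: column \<open>j\<close> has length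
        \<open>r\<close>.\<close>
      have above: "y < l ! (r - 1) + (n - r)"
        using r[of "r - 1"] \<open>i < r\<close> by (simp add: \<beta>_def)
      have below: "l ! r + (n - Suc r) < y" if "r < n"
      proof -
        have "\<beta> r \<noteq> y" using y that by (auto simp: beta)
        then show ?thesis using r[of r] that by (simp add: \<beta>_def)
      qed
      have "n - r \<le> y" using below \<open>r \<le> n\<close> by (cases "r = n") auto
      define j where "j = y - (n - r)"
      have "j < l ! k \<longleftrightarrow> k < r" if "k < n" for k
      proof (cases "k < r")
        case True
        then have "l ! (r - 1) \<le> l ! k" using anti[of k "r - 1"] \<open>r \<le> n\<close> by simp
        then show ?thesis using True above \<open>n - r \<le> y\<close> by (simp add: j_def)
      next
        case False
        then have "l ! k \<le> l ! r" "r < n" using anti[of r k] that by simp_all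
        then show ?thesis using False below by (simp add: j_def)
      qed
      then have "{k. k < length l \<and> j < l ! k} = {..<r}"
        using \<open>r \<le> n\<close> by (auto simp: n_def)
      then have col: "col l j = r" by (simp add: col_def)
      then have j: "j < l ! i" using \<open>i < r\<close> less_col_iff[OF l, of i j] by simp
      then have "hook_length l (i, j) = x - y"
        using hook_length_eq[OF l, of i j] i col \<open>n - r \<le> y\<close> \<open>y < x\<close> \<open>i < r\<close> \<open>r \<le> n\<close>
        by (simp add: n_def \<beta>_def j_def)
      then show "\<not> a dvd x - y"
        using hooks i j by (force simp: ferrers_def n_def)
    qed
  next
    assume gaps: "\<forall>x\<in>beta_set l. \<forall>y<x. y \<notin> beta_set l \<longrightarrow> \<not> a dvd x - y"
    show "\<forall>c\<in>ferrers l. \<not> a dvd hook_length l c"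
    proof
      fix c assume "c \<in> ferrers l"
      then obtain i j where c: "c = (i, j)" and i: "i < n" and j: "j < l ! i"
        by (auto simp: ferrers_def n_def)
      define r where "r = col l j"
      have r: "k < r \<longleftrightarrow> k < n \<and> j < l ! k" for k
        using less_col_iff[OF l] by (simp add: r_def n_def)
      have "r \<le> n" using r[of n] by linarith
      have "i < r" using r i j by simp
      \<comment> \<open>Rows \<open>k < r\<close> have parts above \<open>j\<close> and beta numbers
        above \<open>y\<close>; the other rows have parts at most \<open>j\<close> and beta numbers
        below \<open>y\<close>. So \<open>y\<close> is a gap.\<close>
      define y where "y = j + (n - r)"
      have "y \<noteq> \<beta> k" if "k < n" for k
        using r[of k] that \<open>r \<le> n\<close> by (cases "k < r") (auto simp: y_def \<beta>_def)
      then have "y \<notin> beta_set l" by (auto simp: beta)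
      moreover have "y < \<beta> i"
        using j \<open>i < r\<close> \<open>r \<le> n\<close> by (simp add: y_def \<beta>_def)
      moreover have "hook_length l c = \<beta> i - y"
        using hook_length_eq[OF l, of i j] i j c \<open>i < r\<close> \<open>r \<le> n\<close>
        by (simp add: n_def \<beta>_def y_def flip: r_def)
      ultimately show "\<not> a dvd hook_length l c"
        using gaps i by (simp add: beta)
    qed
  }
qed

section \<open>Cores as down-closed sets\<close>

text \<open>Equivalently, the complement is closed under adding \<open>a\<close>.\<close>

definition down_closed :: "nat \<Rightarrow> nat set \<Rightarrow> bool" where
  "down_closed a X \<longleftrightarrow> (\<forall>x\<in>X. a \<le> x \<longrightarrow> x - a \<in> X)"

lemma down_closed_mult:
  assumes "down_closed a X" "y + k * a \<in> X"
  shows "y \<in> X"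
  using assms(2)
proof (induction k)
  case (Suc k)
  then have "y + Suc k * a - a \<in> X"
    using assms(1) unfolding down_closed_def by (metis add.assoc add.commute le_add1 mult_Suc)
  then show ?case using Suc.IH by simp
qed simp

text \<open>Single steps of \<open>a\<close> suffice: a gap at distance \<open>k * a\<close> below a
  member is excluded by descending \<open>k\<close> times.\<close>

lemma is_core_iff:
  assumes "0 < a"
  shows "is_core a l \<longleftrightarrow> is_partition l \<and> down_closed a (beta_set l)"
proof -
  have *: "(\<forall>x\<in>X. \<forall>y<x. y \<notin> X \<longrightarrow> \<not> a dvd x - y) \<longleftrightarrow> down_closed a X" for X
  proof
    assume gaps: "\<forall>x\<in>X. \<forall>y<x. y \<notin> X \<longrightarrow> \<not> a dvd x - y"
    show "down_closed a X"
      unfolding down_closed_def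
    proof (intro ballI impI)
      fix x assume "x \<in> X" "a \<le> x"
      then show "x - a \<in> X" using gaps[rule_format, of x "x - a"] assms by auto
    qed
  next
    assume dc: "down_closed a X"
    show "\<forall>x\<in>X. \<forall>y<x. y \<notin> X \<longrightarrow> \<not> a dvd x - y"
    proof (intro ballI allI impI notI)
      fix x y assume "x \<in> X" "y < x" "y \<notin> X" "a dvd x - y"
      then obtain k where "x = y + k * a"
        by (metis dvd_def le_add_diff_inverse less_imp_le mult.commute)
      then show False using down_closed_mult[OF dc] \<open>x \<in> X\<close> \<open>y \<notin> X\<close> by blast
    qed
  qed
  show ?thesis
    using no_hook_dvd_iff[of l a] unfolding is_core_def * by blast
qed

lemma bij_betw_beta_set_core:
  assumes "0 < a" "0 < b"
  shows "bij_betw beta_set (core a b)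
    {X. finite X \<and> 0 \<notin> X \<and> down_closed a X \<and> down_closed b X}"
proof (rule bij_betw_imageI)
  show "inj_on beta_set (core a b)"
    by (rule inj_on_subset[OF inj_on_beta_set]) (auto simp: core_def is_core_def)
  show "beta_set ` core a b = {X. finite X \<and> 0 \<notin> X \<and> down_closed a X \<and> down_closed b X}"
  proof (intro equalityI subsetI)
    fix X assume "X \<in> {X. finite X \<and> 0 \<notin> X \<and> down_closed a X \<and> down_closed b X}"
    moreover from this obtain l where "is_partition l" "beta_set l = X"
      using ex_partition_beta_set by blast
    ultimately show "X \<in> beta_set ` core a b"
      by (auto simp: core_def is_core_iff assms)
  qed (auto simp: core_def is_core_iff assms zero_notin_beta_set)
qed

section \<open>Cores and Dyck paths\<close>

text \<open>The index \<open>j\<close> is unbounded since heights are periodic; this makes the step from \<open>j\<close> to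
  \<open>Suc j\<close> uniform.\<close>

definition gaps :: "nat \<Rightarrow> nat list \<Rightarrow> nat set" where
  "gaps b z = {x. \<exists>j. x mod length z = j * b mod length z \<and> int x < height b z j}"

lemma height_eq_if_cong:
  assumes z: "z \<in> compositions a b" and "0 < a" "coprime a b"
    and "i * b mod a = j * b mod a"
  shows "height b z i = height b z j"
proof -
  have "[i = j] (mod a)"
    using assms cong_mult_rcancel_nat[of b a i j] by (simp add: cong_def coprime_commute)
  then show ?thesis
    using height_mod_length[OF z, of i] height_mod_length[OF z, of j] by (simp add: cong_def)
qed

text \<open>The residue of \<open>x\<close> determines \<open>j\<close> modulo \<open>a\<close>, and
  heights have period \<open>a\<close>, so every admissible index gives the same answer.\<close>

lemma mem_gaps_iff:
  assumes z: "z \<in> compositions a b" and "0 < a" "coprime a b" and x: "x mod a = j * b mod a"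
  shows "x \<in> gaps b z \<longleftrightarrow> int x < height b z j"
proof -
  have len: "length z = a" using z by (simp add: compositions_def)
  have "int x < height b z j" if "x mod a = i * b mod a" "int x < height b z i" for i
    using that height_eq_if_cong[OF z assms(2,3), of i j] x by simp
  then show ?thesis
    using x unfolding gaps_def len by blast
qed

lemma ex_mult_mod:
  fixes a b :: nat
  assumes "0 < a" "coprime a b"
  shows "\<exists>j<a. x mod a = j * b mod a"
proof -
  have "x mod a \<in> (\<lambda>j. j * b mod a) ` {..<a}"
    using bij_betw_mult_mod[OF assms(2,1)] assms(1) by (simp add: bij_betw_def)
  then show ?thesis by auto
qed

text \<open>Subtracting \<open>a\<close> keeps the residue class and its bound. Subtracting
  \<open>b\<close> moves from index \<open>Suc j\<close> to \<open>j\<close>, and a height rises by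
  at most \<open>b\<close> per step because the parts are nonnegative.\<close>

lemma gaps_mem:
  assumes z: "z \<in> dyck a b" and "0 < a" "coprime a b"
  shows "finite (gaps b z)" "0 \<notin> gaps b z" "down_closed a (gaps b z)" "down_closed b (gaps b z)"
proof -
  have zc: "z \<in> compositions a b" using z by (simp add: dyck_def)
  then have len: "length z = a" by (simp add: compositions_def)
  note mem = mem_gaps_iff[OF zc assms(2,3)]
  show "finite (gaps b z)"
  proof (rule finite_subset)
    show "gaps b z \<subseteq> (\<Union>j<a. {..<nat (height b z j)})"
    proof
      fix x assume "x \<in> gaps b z"
      moreover obtain j where "j < a" "x mod a = j * b mod a"
        using ex_mult_mod[OF assms(2,3)] by blast
      ultimately have "int x < height b z j"
        using mem by blast
      then show "x \<in> (\<Union>j<a. {..<nat (height b z j)})"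
        using \<open>j < a\<close> by (intro UN_I[of j]) auto
    qed
  qed simp
  show "0 \<notin> gaps b z"
    using mem[of 0 0] by simp
  show "down_closed a (gaps b z)"
    unfolding down_closed_def
  proof (intro ballI impI)
    fix x assume x: "x \<in> gaps b z" "a \<le> x"
    obtain j where j: "x mod a = j * b mod a"
      using ex_mult_mod[OF assms(2,3)] by blast
    then have "(x - a) mod a = j * b mod a"
      using le_mod_geq[OF x(2)] by simp
    then show "x - a \<in> gaps b z"
      using mem[OF j] mem[of "x - a" j] x by linarith
  qed
  show "down_closed b (gaps b z)"
    unfolding down_closed_def
  proof (intro ballI impI)
    fix x assume x: "x \<in> gaps b z" "b \<le> x"
    obtain j where j: "(x - b) mod a = j * b mod a"
      using ex_mult_mod[OF assms(2,3)] by blast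
    have "x mod a = Suc j * b mod a"
      using x(2) j mod_add_cong[of "x - b" a "j * b" b b] by (simp add: add.commute)
    then have "int x < height b z (Suc j)"
      using x(1) mem by blast
    moreover have "0 \<le> int (length z) * int (z ! (j mod length z))"
      by simp
    ultimately have "int x < height b z j + int b"
      unfolding height_Suc by linarith
    then show "x - b \<in> gaps b z"
      using mem[OF j] x(2) by simp
  qed
qed

lemma inj_on_gaps:
  assumes "0 < a" "coprime a b"
  shows "inj_on (gaps b) (dyck a b)"
proof (rule inj_onI)
  fix z w assume z: "z \<in> dyck a b" and w: "w \<in> dyck a b" and eq: "gaps b z = gaps b w"
  have zc: "z \<in> compositions a b" and wc: "w \<in> compositions a b"
    using z w by (simp_all add: dyck_def)
  have le: "height b u j \<le> height b v j"
    if "u \<in> dyck a b" "v \<in> dyck a b" "gaps b u = gaps b v" for u v j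
  proof (rule ccontr)
    assume less: "\<not> height b u j \<le> height b v j"
    have c: "u \<in> compositions a b" "v \<in> compositions a b" "0 \<le> height b v j"
      using that by (simp_all add: dyck_def)
    \<comment> \<open>This number has residue \<open>j * b\<close>; it lies in
      \<open>gaps b u\<close>, being below the height of \<open>u\<close>, but not in
      \<open>gaps b v\<close>.\<close>
    define x where "x = nat (height b v j)"
    have "int (x mod a) = int (j * b mod a)"
      using c(3) height_mod[OF c(2), of j] by (simp add: x_def zmod_int)
    then have x: "x mod a = j * b mod a" by (simp only: of_nat_eq_iff)
    show False
      using mem_gaps_iff[OF c(1) assms x] mem_gaps_iff[OF c(2) assms x] that(3) less c(3)
      by (simp add: x_def)
  qed
  have heights: "height b z j = height b w j" for j
    using le[OF z w eq] le[OF w z eq[symmetric]] by (meson order_antisym)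
  have len: "length z = a" "length w = a" using zc wc by (simp_all add: compositions_def)
  show "z = w"
  proof (rule nth_equalityI)
    fix i assume "i < length z"
    \<comment> \<open>Successive heights differ by \<open>b - a * z ! i\<close>, so they determine
      the parts.\<close>
    then show "z ! i = w ! i"
      using height_Suc[of b z i] height_Suc[of b w i] heights[of i] heights[of "Suc i"] len assms
      by simp
  qed (simp add: len)
qed

text \<open>The heights must be the least non-members \<open>Y j\<close> of \<open>X\<close> in the
  residue classes of \<open>j * b\<close>; being natural numbers, they make the resulting path
  Dyck.\<close>

lemma ex_dyck_gaps:
  assumes "0 < a" "coprime a b"
    and X: "finite X" "0 \<notin> X" "down_closed a X" "down_closed b X"
  shows "\<exists>z\<in>dyck a b. gaps b z = X"
proof -
  define Y where "Y j = (LEAST x. x mod a = j * b mod a \<and> x \<notin> X)" for j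
  \<comment> \<open>Otherwise \<open>j\<close> descents by \<open>b\<close> would put 0 into
    \<open>X\<close>. So every class of \<open>j * b\<close> has a non-member.\<close>
  have "j * b \<notin> X" for j
    using down_closed_mult[OF X(4), of 0 j] X(2) by auto
  then have ex: "\<exists>x. x mod a = j * b mod a \<and> x \<notin> X" for j by blast
  have Y: "Y j mod a = j * b mod a" "Y j \<notin> X" for j
    using LeastI_ex[OF ex[of j]] by (simp_all add: Y_def)
  have Y_le: "Y j \<le> x" if "x mod a = j * b mod a" "x \<notin> X" for x j
    unfolding Y_def using that by (intro Least_le) simp
  have Y_0: "Y 0 = 0"
    using Y_le[of 0 0] X(2) by simp
  have Y_per: "Y (j mod a) = Y j" for j
    by (simp add: Y_def mod_mult_left_eq)
  have Y_Suc: "Y (Suc j) \<le> Y j + b" for j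
  proof (rule Y_le)
    show "(Y j + b) mod a = Suc j * b mod a"
      using mod_add_cong[OF Y(1) refl, of j b] by (simp add: add.commute)
    show "Y j + b \<notin> X"
      using Y(2)[of j] X(4) by (auto simp: down_closed_def)
  qed
  have dvd: "a dvd Y j + b - Y (Suc j)" for j
  proof -
    have "(Y j + b) mod a = Y (Suc j) mod a"
      using mod_add_cong[OF Y(1) refl, of j b] Y(1)[of "Suc j"] by (simp add: add.commute)
    then show ?thesis
      using Y_Suc by (metis mod_eq_dvd_iff_nat)
  qed
  \<comment> \<open>Solves \<open>height_Suc\<close> for the parts; \<open>Y_Suc\<close> and
    \<open>dvd\<close> make the quotient a natural number without remainder.\<close>
  define z where "z = map (\<lambda>j. (Y j + b - Y (Suc j)) div a) [0..<a]"
  have len: "length z = a" by (simp add: z_def)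
  have step: "int a * int (z ! (j mod a)) = int (Y j) + int b - int (Y (Suc j))" for j
  proof -
    have "z ! (j mod a) = (Y (j mod a) + b - Y (Suc (j mod a))) div a"
      using assms(1) by (simp add: z_def)
    moreover have "Y (Suc (j mod a)) = Y (Suc j)"
      using Y_per[of "Suc (j mod a)"] Y_per[of "Suc j"] by (simp add: mod_Suc_eq)
    ultimately have "a * z ! (j mod a) = Y j + b - Y (Suc j)"
      using dvd[of j] by (simp add: Y_per)
    then show ?thesis
      using Y_Suc[of j] by (metis of_nat_add of_nat_diff of_nat_mult)
  qed
  have height: "height b z j = int (Y j)" for j
    by (induction j) (simp_all add: Y_0 height_Suc len step)
  \<comment> \<open>The path returns to height 0 after \<open>a\<close> steps, which forces the
    parts to sum to \<open>b\<close>.\<close>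
  have "Y a = 0" using Y_per[of a] Y_0 by simp
  then have "int (a * b) = int (a * sum_list z)"
    using height[of a] psum_eq_take[of a z] by (simp add: height_def len)
  then have "sum_list z = b"
    using assms(1) by (simp only: of_nat_eq_iff mult_left_cancel)
  then have z: "z \<in> dyck a b"
    using height by (simp add: dyck_def compositions_def len)
  then have zc: "z \<in> compositions a b" by (simp add: dyck_def)
  have "x \<in> gaps b z \<longleftrightarrow> x \<in> X" for x
  proof -
    obtain j where j: "x mod a = j * b mod a"
      using ex_mult_mod[OF assms(1,2)] by blast
    have "x < Y j \<longleftrightarrow> x \<in> X"
    proof
      assume "x < Y j"
      then show "x \<in> X" using Y_le[OF j] by (meson not_le)
    next
      assume x: "x \<in> X"
      show "x < Y j"
      proof (rule ccontr)
        assume "\<not> x < Y j"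
        then have "a dvd x - Y j"
          using j Y(1)[of j] mod_eq_dvd_iff_nat[of "Y j" x a] by simp
        then obtain k where "x - Y j = a * k" by (elim dvdE)
        then have "Y j + k * a = x"
          using \<open>\<not> x < Y j\<close> by (subst mult.commute) linarith
        then show False
          using down_closed_mult[OF X(3), of "Y j" k] x Y(2)[of j] by simp
      qed
    qed
    then show ?thesis
      using mem_gaps_iff[OF zc assms(1,2) j] by (simp add: height)
  qed
  then show ?thesis using z by blast
qed

lemma bij_betw_gaps:
  assumes "0 < a" "coprime a b"
  shows "bij_betw (gaps b) (dyck a b)
    {X. finite X \<and> 0 \<notin> X \<and> down_closed a X \<and> down_closed b X}"
proof (rule bij_betw_imageI[OF inj_on_gaps[OF assms]])
  show "gaps b ` dyck a b = {X. finite X \<and> 0 \<notin> X \<and> down_closed a X \<and> down_closed b X}"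
  proof (intro equalityI subsetI)
    fix X assume "X \<in> {X. finite X \<and> 0 \<notin> X \<and> down_closed a X \<and> down_closed b X}"
    then show "X \<in> gaps b ` dyck a b"
      using ex_dyck_gaps[OF assms, of X] by blast
  qed (use gaps_mem[OF _ assms] in blast)
qed

section \<open>The size of a core in terms of heights\<close>

text \<open>An arithmetic progression with difference \<open>a\<close>, summed in terms of
  \<open>y\<close> and \<open>y mod a\<close> so that the residues can later be summed
  separately.\<close>

lemma sum_residue_class:
  fixes a y :: nat
  assumes "0 < a"
  defines "C \<equiv> {x. x mod a = y mod a \<and> x < y}"
  shows "real (card C) = (real y - real (y mod a)) / a"
    and "(\<Sum>x\<in>C. real x) = (real y ^ 2 - real (y mod a) ^ 2) / (2 * a) - (real y - real (y mod a)) / 2"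
proof -
  define r q where "r = y mod a" and "q = y div a"
  have y: "y = r + a * q" by (simp add: r_def q_def)
  have "C = (\<lambda>i. r + a * i) ` {..<q}"
  proof (intro equalityI subsetI)
    fix x assume "x \<in> C"
    then have x: "x mod a = r" "x < y" by (simp_all add: C_def r_def)
    then have "x = r + a * (x div a)" by (metis mod_mult_div_eq)
    moreover from this have "x div a < q"
      using x(2) y by (metis add_less_cancel_left nat_mult_less_cancel_disj)
    ultimately show "x \<in> (\<lambda>i. r + a * i) ` {..<q}" by blast
  next
    fix x assume "x \<in> (\<lambda>i. r + a * i) ` {..<q}"
    then obtain i where i: "x = r + a * i" "i < q" by blast
    have "x mod a = y mod a" by (simp add: i r_def)
    moreover have "x < y" by (subst y) (simp add: i assms(1))
    ultimately show "x \<in> C" by (simp add: C_def)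
  qed
  moreover have inj: "inj_on (\<lambda>i. r + a * i) {..<q}"
    using assms(1) by (auto simp: inj_on_def)
  ultimately have card: "card C = q" and sum: "(\<Sum>x\<in>C. real x) = (\<Sum>i<q. real (r + a * i))"
    by (simp_all add: card_image sum.reindex)
  have "real y = real r + real a * real q" by (subst y) simp
  then show "real (card C) = (real y - real (y mod a)) / a"
    using assms(1) by (simp add: card flip: r_def)
  have "(\<Sum>i<q. real (r + a * i)) = real r * q + a * (real q * (real q - 1) / 2)" for q
    by (induction q) (simp_all add: field_simps)
  then have S: "(\<Sum>x\<in>C. real x) = real r * q + a * (real q * (real q - 1) / 2)"
    by (simp only: sum)
  show "(\<Sum>x\<in>C. real x) =
      (real y ^ 2 - real (y mod a) ^ 2) / (2 * a) - (real y - real (y mod a)) / 2"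
    unfolding S r_def[symmetric] \<open>real y = _\<close>
    using assms(1) by (simp add: field_simps power2_eq_square)
qed

text \<open>By \<open>sum_beta_set\<close> the size depends on the number and the sum of the gaps,
  which split into the progressions below the heights. The residues contribute constants depending
  on \<open>a\<close> alone.\<close>

lemma size_eq_spread:
  assumes l: "is_partition l" and z: "z \<in> dyck a b" and "0 < a" "coprime a b"
    and eq: "beta_set l = gaps b z"
  shows "real (partition_size l) = spread (real b / real a) z - (real a ^ 2 - 1) / 24"
proof -
  have zc: "z \<in> compositions a b" using z by (simp add: dyck_def)
  define y where "y j = nat (height b z j)" for j
  have y: "real_of_int (height b z j) = real (y j)" "int (y j) = height b z j" for j
    using z by (simp_all add: dyck_def y_def)
  have y_mod: "y j mod a = j * b mod a" for j
    using height_mod[OF zc, of j] unfolding y(2)[symmetric] by (metis of_nat_eq_iff zmod_int)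
  define C where "C j = {x. x mod a = y j mod a \<and> x < y j}" for j
  have C: "gaps b z = (\<Union>j<a. C j)"
  proof (intro equalityI subsetI)
    fix x assume "x \<in> gaps b z"
    moreover obtain j where "j < a" "x mod a = j * b mod a"
      using ex_mult_mod[OF assms(3,4)] by blast
    ultimately show "x \<in> (\<Union>j<a. C j)"
      using mem_gaps_iff[OF zc assms(3,4), of x j] y(2)[of j] by (auto simp: C_def y_mod)
  next
    fix x assume "x \<in> (\<Union>j<a. C j)"
    then show "x \<in> gaps b z"
      using mem_gaps_iff[OF zc assms(3,4), of x] by (auto simp: C_def y_mod simp flip: y(2))
  qed
  have fin: "finite (C j)" for j by (simp add: C_def)
  have disj: "C i \<inter> C j = {}" if "i < a" "j < a" "i \<noteq> j" for i j
  proof -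
    have "i * b mod a \<noteq> j * b mod a"
      using that inj_onD[OF bij_betw_imp_inj_on[OF bij_betw_mult_mod[OF assms(4,3)]], of i j]
      by blast
    then show ?thesis by (auto simp: C_def y_mod)
  qed
  define R1 R2 s q where "R1 = (\<Sum>r<a. real r)" and "R2 = (\<Sum>r<a. real r ^ 2)"
    and "s = (\<Sum>j<a. real (y j))" and "q = (\<Sum>j<a. real (y j) ^ 2)"
  \<comment> \<open>By coprimality the residues of the heights run through
    \<open>0, ..., a - 1\<close> once each.\<close>
  have R: "(\<Sum>j<a. f (y j mod a)) = (\<Sum>r<a. f r)" for f :: "nat \<Rightarrow> real"
    using sum.reindex_bij_betw[OF bij_betw_mult_mod[OF assms(4,3)], of f] by (simp add: y_mod)
  have R1: "R1 = real a * (real a - 1) / 2"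
    unfolding R1_def by (induction a) (simp_all add: field_simps)
  have R2: "R2 = (real a - 1) * real a * (2 * real a - 1) / 6"
    unfolding R2_def by (induction a) (simp_all add: field_simps power2_eq_square)
  have "real (length l) = (\<Sum>j<a. real (card (C j)))"
    unfolding card_beta_set[OF l, symmetric] eq C
    using fin disj by (subst card_UN_disjoint) auto
  also have "\<dots> = (\<Sum>j<a. (real (y j) - real (y j mod a)) / a)"
    unfolding C_def sum_residue_class(1)[OF assms(3)] ..
  also have "\<dots> = (s - R1) / a"
    using R[of real] by (simp add: sum_subtractf s_def R1_def flip: sum_divide_distrib)
  finally have len: "real (length l) = (s - R1) / a" .
  have "(\<Sum>x\<in>beta_set l. real x) = (\<Sum>j<a. \<Sum>x\<in>C j. real x)"
    unfolding eq C using fin disj by (subst sum.UNION_disjoint) auto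
  also have "\<dots> = (\<Sum>j<a. (real (y j) ^ 2 - real (y j mod a) ^ 2) / (2 * a) -
      (real (y j) - real (y j mod a)) / 2)"
    unfolding C_def sum_residue_class(2)[OF assms(3)] ..
  also have "\<dots> = (q - R2) / (2 * a) - (s - R1) / 2"
    using R[of real] R[of "\<lambda>r. real r ^ 2"]
    by (simp add: sum_subtractf s_def R1_def q_def R2_def flip: sum_divide_distrib)
  finally have sum: "(\<Sum>x\<in>beta_set l. real x) = (q - R2) / (2 * a) - (s - R1) / 2" .
  have arith: "x = y - w / 2" if "2 * y = 2 * x + w" for x y w :: real
    using that by simp
  have size: "real (partition_size l) =
      (q - R2) / (2 * a) - (s - R1) / 2 - (s - R1) / a * ((s - R1) / a - 1) / 2"
    by (rule arith[OF sum_beta_set[OF l, unfolded len sum]])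
  have spread: "spread (real b / real a) z = (q / a - s ^ 2 / a ^ 2) / 2"
    using spread_eq_heights[OF zc assms(3)] by (simp add: y(1) q_def s_def)
  \<comment> \<open>The terms linear in \<open>s\<close> cancel because
    \<open>R1 / a^2 = 1/2 - 1/(2 a)\<close>; the constants add up to
    \<open>-(a^2 - 1) / 24\<close>.\<close>
  show ?thesis
    unfolding size spread R1 R2 using assms(3) by (simp add: field_simps power2_eq_square)
qed

section \<open>Transfer of averages from compositions to cores\<close>

lemma finite_core:
  assumes "0 < a" "0 < b" "coprime a b"
  shows "finite (core a b)"
proof -
  have "finite (dyck a b)"
    by (rule finite_subset[OF _ finite_compositions]) (auto simp: dyck_def)
  then show ?thesis
    using bij_betw_finite[OF bij_betw_beta_set_core] bij_betw_finite[OF bij_betw_gaps] assms by blast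
qed

text \<open>With \<open>F\<close> arbitrary, the number of cores, their mean size and the third
  central moment are all instances.\<close>

lemma sum_core_eq:
  fixes F :: "real \<Rightarrow> real"
  assumes "0 < a" "0 < b" "coprime a b"
  shows "a * (\<Sum>l\<in>core a b. F (real (partition_size l))) =
    (\<Sum>z\<in>compositions a b. F (spread (real b / real a) z - (real a ^ 2 - 1) / 24))"
proof -
  let ?G = "\<lambda>z. F (spread (real b / real a) z - (real a ^ 2 - 1) / 24)"
  let ?S = "{X. finite X \<and> 0 \<notin> X \<and> down_closed a X \<and> down_closed b X}"
  define g where "g = inv_into (dyck a b) (gaps b)"
  have g: "bij_betw g ?S (dyck a b)"
    unfolding g_def by (rule bij_betw_inv_into[OF bij_betw_gaps[OF assms(1,3)]])
  have bij: "bij_betw (g \<circ> beta_set) (core a b) (dyck a b)"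
    by (rule bij_betw_trans[OF bij_betw_beta_set_core[OF assms(1,2)] g])
  have "F (real (partition_size l)) = ?G ((g \<circ> beta_set) l)" if "l \<in> core a b" for l
  proof -
    have "beta_set l \<in> gaps b ` dyck a b"
      using bij_betwE[OF bij_betw_beta_set_core[OF assms(1,2)]] that
      unfolding bij_betw_imp_surj_on[OF bij_betw_gaps[OF assms(1,3)]] by blast
    then have "beta_set l = gaps b (g (beta_set l))" "g (beta_set l) \<in> dyck a b"
      unfolding g_def by (simp_all add: f_inv_into_f inv_into_into)
    moreover have "is_partition l" using that by (simp add: core_def is_core_def)
    ultimately show ?thesis
      using size_eq_spread[of l "g (beta_set l)" a b] assms by simp
  qed
  then have "(\<Sum>l\<in>core a b. F (real (partition_size l))) = (\<Sum>l\<in>core a b. ?G ((g \<circ> beta_set) l))"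
    by (rule sum.cong[OF refl])
  also have "\<dots> = (\<Sum>z\<in>dyck a b. ?G z)"
    by (rule sum.reindex_bij_betw[OF bij])
  finally have "a * (\<Sum>l\<in>core a b. F (real (partition_size l))) = a * (\<Sum>z\<in>dyck a b. ?G z)"
    by simp
  also have "\<dots> = (\<Sum>z\<in>compositions a b. ?G z)"
    by (rule sum_compositions_eq_dyck[OF assms(1,3), symmetric])
      (simp only: spread_rotate[OF _ assms(1)])
  finally show ?thesis .
qed

text \<open>The closed form is the averaged third central moment. For \<open>(a, b) = (2, 5)\<close>
  the sizes are 0, 1, 3: the average is 20/27, the plain sum of cubes 20/9.\<close>

theorem theorem1p6:
  fixes a b :: nat
  assumes "a > 0" and "b > 0" and "coprime a b"
  shows "finite (core a b) \<and>
    (\<Sum>l\<in>core a b. (real (partition_size l) - mean_core_size a b) ^ 3) / real (card (core a b)) =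
      real a * real b * (real a - 1) * (real b - 1) * (real a + real b) * (real a + real b + 1) *
      (2 * real a ^ 2 * real b - 3 * real a ^ 2 + 2 * real a * real b ^ 2
        - 3 * real a * real b - 3 * real b ^ 2 - 3) / 60480"
proof
  show "finite (core a b)" by (rule finite_core[OF assms])
  define f where "f = spread (real b / real a)"
  define K where "K = (real a ^ 2 - 1) / 24"
  define N where "N = real (card (compositions a b))"
  have sum: "(\<Sum>l\<in>core a b. F (real (partition_size l))) =
      (\<Sum>z\<in>compositions a b. F (f z - K)) / a" for F :: "real \<Rightarrow> real"
    using sum_core_eq[OF assms, of F] assms(1) by (simp add: f_def K_def field_simps)
  have "0 < card (compositions a b)"
    unfolding compositions_def using card_length_sum_list[of a b] assms by simp
  then have N: "0 < N" by (simp add: N_def)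
  have card: "real (card (core a b)) = N / a"
    using sum[of "\<lambda>_. 1"] by (simp add: N_def)
  have "mean_core_size a b = (\<Sum>z\<in>compositions a b. f z - K) / N"
    using sum[of "\<lambda>x. x"] assms(1) by (simp add: mean_core_size_def card)
  also have "\<dots> = (\<Sum>z\<in>compositions a b. f z) / N - K"
    using N by (simp add: sum_subtractf diff_divide_distrib flip: N_def)
  finally have mean: "mean_core_size a b = (\<Sum>z\<in>compositions a b. f z) / N - K" .
  \<comment> \<open>The shift \<open>K\<close> enters each size and the mean alike and cancels; so
    does the factor \<open>1 / a\<close> in the sum and in the number of cores.\<close>
  have "(\<Sum>l\<in>core a b. (real (partition_size l) - mean_core_size a b) ^ 3) / real (card (core a b)) =
      (\<Sum>z\<in>compositions a b. (f z - (\<Sum>z\<in>compositions a b. f z) / N) ^ 3) / N"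
    using sum[of "\<lambda>x. (x - mean_core_size a b) ^ 3"] assms(1) by (simp add: card mean)
  also have "\<dots> = real a * real b * (real a - 1) * (real b - 1) * (real a + real b) *
      (real a + real b + 1) * (2 * real a ^ 2 * real b - 3 * real a ^ 2 + 2 * real a * real b ^ 2
        - 3 * real a * real b - 3 * real b ^ 2 - 3) / 60480"
    unfolding f_def N_def by (rule third_central_moment_spread[OF assms(1)])
  finally show "(\<Sum>l\<in>core a b. (real (partition_size l) - mean_core_size a b) ^ 3) /
      real (card (core a b)) = real a * real b * (real a - 1) * (real b - 1) * (real a + real b) *
      (real a + real b + 1) * (2 * real a ^ 2 * real b - 3 * real a ^ 2 + 2 * real a * real b ^ 2
        - 3 * real a * real b - 3 * real b ^ 2 - 3) / 60480" .
qed

end
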